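(* Let $\mathbf{k}$ be any field, and let $\mathbf{R}$ be the inverse limit, in the category of graded rings, of the standard-graded polynomial rings $\mathbf{k}[x_1,\ldots,x_n]$ for $n\ge 1$. Then $\mathbf{R}$ is a polynomial ring (over $\mathbf{k}$, in some possibly infinite set of variables).
   Context: Graded means graded by the non-negative integers. The transition maps $\mathbf{k}[x_1,\ldots,x_{n+1}]\to\mathbf{k}[x_1,\ldots,x_n]$ are the $\mathbf{k}$-algebra maps sending $x_{n+1}\mapsto 0$ and fixing $x_1,\dots,x_n$. Concretely, $\mathbf{R}=\bigoplus_{d\ge 0}\mathbf{R}_d$, where $\mathbf{R}_d$ is the set of all formal, perhaps infinite, $\mathbf{k}$-linear combinations of degree $d$ monomials in the variables $\{x_i\}_{i\ge 1}$, with the usual multiplication. A graded ring $R$ with $R_0=\mathbf{k}$ a field is said to be a polynomial ring if there is a set of homogeneous elements of positive degree in $R$ that is algebraically independent over $\mathbf{k}$ and generates $R$ as a $\mathbf{k}$-algebra. *)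

theory Defs
  imports "HOL-Library.Poly_Mapping"
begin

section \<open>Graded rings and polynomial rings\<close>

locale graded_ring =
  fixes G :: "nat \<Rightarrow> 'r::comm_ring_1 set"
  assumes zero_mem: "0 \<in> G d"
    and add_mem: "x \<in> G d \<Longrightarrow> y \<in> G d \<Longrightarrow> x + y \<in> G d"
    and uminus_mem: "x \<in> G d \<Longrightarrow> - x \<in> G d"
    and one_mem: "1 \<in> G 0"
    and mult_mem: "x \<in> G d \<Longrightarrow> y \<in> G e \<Longrightarrow> x * y \<in> G (d + e)"
    and direct_sum:
      "\<exists>!g. (\<forall>d. g d \<in> G d) \<and> finite {d. g d \<noteq> 0} \<and> r = (\<Sum>d | g d \<noteq> 0. g d)"

definition graded_hom ::
  "(nat \<Rightarrow> 'r::comm_ring_1 set) \<Rightarrow> (nat \<Rightarrow> 's::comm_ring_1 set) \<Rightarrow> ('r \<Rightarrow> 's) \<Rightarrow> bool" where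
  "graded_hom G H u \<longleftrightarrow>
     u 1 = 1 \<and> (\<forall>x y. u (x + y) = u x + u y) \<and> (\<forall>x y. u (x * y) = u x * u y) \<and>
     (\<forall>d. \<forall>x\<in>G d. u x \<in> H d)"

text \<open>A graded ring \<open>R\<close> with \<open>R\<^sub>0 = k\<close>; the identification is the structure map \<open>c\<close>.\<close>

locale connected_graded_algebra = graded_ring G
  for c :: "'k::field \<Rightarrow> 'r::comm_ring_1" and G :: "nat \<Rightarrow> 'r set" +
  assumes c_one: "c 1 = 1"
    and c_add: "c (a + b) = c a + c b"
    and c_mult: "c (a * b) = c a * c b"
    and c_bij: "bij_betw c UNIV (G 0)"

text \<open>Polynomials with coefficients in \<open>'k\<close> and variables in \<open>'i\<close> are the elements of the monoid
  algebra \<open>('i \<Rightarrow>\<^sub>0 nat) \<Rightarrow>\<^sub>0 'k\<close>; an element of \<open>'i \<Rightarrow>\<^sub>0 nat\<close> is the exponent vector of a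
  monomial.\<close>

definition mon_eval :: "('i \<Rightarrow> 'r::comm_ring_1) \<Rightarrow> ('i \<Rightarrow>\<^sub>0 nat) \<Rightarrow> 'r" where
  "mon_eval h m = (\<Prod>i\<in>Poly_Mapping.keys m. h i ^ Poly_Mapping.lookup m i)"

definition poly_eval ::
  "('k::comm_ring_1 \<Rightarrow> 'r::comm_ring_1) \<Rightarrow> ('i \<Rightarrow> 'r) \<Rightarrow> (('i \<Rightarrow>\<^sub>0 nat) \<Rightarrow>\<^sub>0 'k) \<Rightarrow> 'r" where
  "poly_eval c h p = (\<Sum>m\<in>Poly_Mapping.keys p. c (Poly_Mapping.lookup p m) * mon_eval h m)"

text \<open>The elements of \<open>S\<close> serve as names of variables, each to be evaluated at itself.\<close>

definition alg_independent :: "('k::field \<Rightarrow> 'r::comm_ring_1) \<Rightarrow> 'r set \<Rightarrow> bool" where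
  "alg_independent c S \<longleftrightarrow>
     (\<forall>p :: ('r \<Rightarrow>\<^sub>0 nat) \<Rightarrow>\<^sub>0 'k.
        (\<forall>m\<in>Poly_Mapping.keys p. Poly_Mapping.keys m \<subseteq> S) \<longrightarrow> poly_eval c (\<lambda>s. s) p = 0 \<longrightarrow> p = 0)"

inductive_set generated_algebra :: "('k::field \<Rightarrow> 'r::comm_ring_1) \<Rightarrow> 'r set \<Rightarrow> 'r set"
  for c :: "'k \<Rightarrow> 'r" and S :: "'r set" where
  const: "c a \<in> generated_algebra c S"
| incl: "s \<in> S \<Longrightarrow> s \<in> generated_algebra c S"
| add: "x \<in> generated_algebra c S \<Longrightarrow> y \<in> generated_algebra c S \<Longrightarrow> x + y \<in> generated_algebra c S"
| mult: "x \<in> generated_algebra c S \<Longrightarrow> y \<in> generated_algebra c S \<Longrightarrow> x * y \<in> generated_algebra c S"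

definition is_polynomial_ring ::
  "('k::field \<Rightarrow> 'r::comm_ring_1) \<Rightarrow> (nat \<Rightarrow> 'r set) \<Rightarrow> bool" where
  "is_polynomial_ring c G \<longleftrightarrow>
     connected_graded_algebra c G \<and>
     (\<exists>S. S \<subseteq> (\<Union>d\<in>{1..}. G d) \<and> alg_independent c S \<and> generated_algebra c S = UNIV)"


section \<open>The inverse system\<close>

text \<open>The variables are \<open>x\<^sub>0, x\<^sub>1, \<dots>\<close>, and the \<open>n\<close>-th ring of the system is
  \<open>k[x\<^sub>0,\<dots>,x\<^sub>n]\<close>. Thus \<open>n = 0, 1, \<dots>\<close> runs through the polynomial rings in
  at least one variable. All of them are viewed inside one type.\<close>

type_synonym 'k mpoly = "(nat \<Rightarrow>\<^sub>0 nat) \<Rightarrow>\<^sub>0 'k"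

definition mdeg :: "(nat \<Rightarrow>\<^sub>0 nat) \<Rightarrow> nat" where
  "mdeg m = (\<Sum>i\<in>Poly_Mapping.keys m. Poly_Mapping.lookup m i)"

definition poly_const :: "'k::field \<Rightarrow> 'k mpoly" where
  "poly_const a = Poly_Mapping.single 0 a"

definition poly_var :: "nat \<Rightarrow> 'k::field mpoly" where
  "poly_var i = Poly_Mapping.single (Poly_Mapping.single i 1) 1"

definition poly_component :: "nat \<Rightarrow> nat \<Rightarrow> 'k::field mpoly set" where
  "poly_component n d = {p. \<forall>m\<in>Poly_Mapping.keys p. Poly_Mapping.keys m \<subseteq> {..n} \<and> mdeg m = d}"

definition transition :: "nat \<Rightarrow> 'k::field mpoly \<Rightarrow> 'k mpoly" where
  "transition n = poly_eval poly_const (\<lambda>i. if i = Suc n then 0 else poly_var i)"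

text \<open>The inverse limit of graded rings is the direct sum over \<open>d\<close> of the inverse limits of the degree
  \<open>d\<close> components.\<close>

definition limit_component :: "nat \<Rightarrow> (nat \<Rightarrow> 'k::field mpoly) set" where
  "limit_component d =
     {f. \<forall>n. f n \<in> poly_component n d \<and> transition n (f (Suc n)) = f n}"

definition limit_carrier :: "(nat \<Rightarrow> 'k::field mpoly) set" where
  "limit_carrier = {\<lambda>n. \<Sum>d\<le>D. g d n | D g. \<forall>d. g d \<in> limit_component d}"


subsection \<open>Evaluation and transition maps\<close>

lemma mon_eval_superset:
  assumes "finite A" "Poly_Mapping.keys m \<subseteq> A"
  shows "mon_eval h m = (\<Prod>i\<in>A. h i ^ Poly_Mapping.lookup m i)"
  unfolding mon_eval_def
  by (rule prod.mono_neutral_left) (use assms in \<open>auto simp: in_keys_iff\<close>)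

lemma mon_eval_zero [simp]: "mon_eval h 0 = 1"
  by (simp add: mon_eval_def)

lemma mon_eval_add: "mon_eval h (m + m') = mon_eval h m * mon_eval h m'"
proof -
  let ?A = "Poly_Mapping.keys m \<union> Poly_Mapping.keys m'"
  have "mon_eval h (m + m') = (\<Prod>i\<in>?A. h i ^ Poly_Mapping.lookup (m + m') i)"
    by (rule mon_eval_superset) (use keys_add[of m m'] in auto)
  also have "\<dots> = (\<Prod>i\<in>?A. h i ^ Poly_Mapping.lookup m i) * (\<Prod>i\<in>?A. h i ^ Poly_Mapping.lookup m' i)"
    by (simp add: lookup_add power_add prod.distrib)
  also have "\<dots> = mon_eval h m * mon_eval h m'"
    by (simp add: mon_eval_superset[symmetric])
  finally show ?thesis .
qed

lemma poly_mapping_sum_singles: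
  "p = (\<Sum>m\<in>Poly_Mapping.keys p. Poly_Mapping.single m (Poly_Mapping.lookup p m))"
  by (rule poly_mapping_eqI) (auto simp: lookup_sum lookup_single when_def in_keys_iff)

locale coefficient_hom =
  fixes c :: "'k::comm_ring_1 \<Rightarrow> 'r::comm_ring_1"
  assumes hom_one: "c 1 = 1"
    and hom_add: "c (a + b) = c a + c b"
    and hom_mult: "c (a * b) = c a * c b"
begin

lemma hom_zero: "c 0 = 0"
  using hom_add[of 0 0] by simp

lemma poly_eval_superset:
  assumes "finite A" "Poly_Mapping.keys p \<subseteq> A"
  shows "poly_eval c h p = (\<Sum>m\<in>A. c (Poly_Mapping.lookup p m) * mon_eval h m)"
  unfolding poly_eval_def
  by (rule sum.mono_neutral_left) (use assms in \<open>auto simp: in_keys_iff hom_zero\<close>)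

lemma poly_eval_zero: "poly_eval c h 0 = 0"
  by (simp add: poly_eval_def)

lemma poly_eval_single: "poly_eval c h (Poly_Mapping.single m a) = c a * mon_eval h m"
  by (simp add: poly_eval_def hom_zero)

lemma poly_eval_one: "poly_eval c h 1 = 1"
  using poly_eval_single[of h 0 1] by (simp add: hom_one)

lemma poly_eval_add: "poly_eval c h (p + q) = poly_eval c h p + poly_eval c h q"
proof -
  let ?A = "Poly_Mapping.keys p \<union> Poly_Mapping.keys q"
  have "poly_eval c h (p + q) = (\<Sum>m\<in>?A. c (Poly_Mapping.lookup (p + q) m) * mon_eval h m)"
    by (rule poly_eval_superset) (use keys_add[of p q] in auto)
  also have "\<dots> = (\<Sum>m\<in>?A. c (Poly_Mapping.lookup p m) * mon_eval h m) + (\<Sum>m\<in>?A. c (Poly_Mapping.lookup q m) * mon_eval h m)"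
    by (simp add: lookup_add hom_add sum.distrib distrib_right)
  also have "\<dots> = poly_eval c h p + poly_eval c h q"
    by (simp add: poly_eval_superset[symmetric])
  finally show ?thesis .
qed

lemma poly_eval_sum: "poly_eval c h (sum f A) = (\<Sum>a\<in>A. poly_eval c h (f a))"
  by (induction A rule: infinite_finite_induct) (auto simp: poly_eval_zero poly_eval_add)

lemma poly_eval_mult: "poly_eval c h (p * q) = poly_eval c h p * poly_eval c h q"
proof -
  have "p * q = (\<Sum>m\<in>Poly_Mapping.keys p. \<Sum>m'\<in>Poly_Mapping.keys q. Poly_Mapping.single (m + m') (Poly_Mapping.lookup p m * Poly_Mapping.lookup q m'))"
    by (subst poly_mapping_sum_singles[of p], subst poly_mapping_sum_singles[of q])
       (simp add: sum_product mult_single)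
  hence "poly_eval c h (p * q) = (\<Sum>m\<in>Poly_Mapping.keys p. \<Sum>m'\<in>Poly_Mapping.keys q.
           (c (Poly_Mapping.lookup p m) * mon_eval h m) * (c (Poly_Mapping.lookup q m') * mon_eval h m'))"
    by (simp add: poly_eval_sum poly_eval_single mon_eval_add hom_mult mult_ac)
  thus ?thesis by (simp add: poly_eval_def sum_product)
qed

end

lemma poly_const_hom: "coefficient_hom (poly_const :: 'k::field \<Rightarrow> 'k mpoly)"
  by unfold_locales (auto simp: poly_const_def single_add mult_single)

lemma transition_add: "transition n (p + q) = transition n p + transition n q"
  unfolding transition_def by (rule coefficient_hom.poly_eval_add[OF poly_const_hom])

lemma transition_mult: "transition n (p * q) = transition n p * transition n q"
  unfolding transition_def by (rule coefficient_hom.poly_eval_mult[OF poly_const_hom])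

lemma transition_one: "transition n 1 = 1"
  unfolding transition_def by (rule coefficient_hom.poly_eval_one[OF poly_const_hom])

lemma transition_const: "transition n (poly_const a) = poly_const a"
  by (simp add: transition_def poly_const_def[of a]
      coefficient_hom.poly_eval_single[OF poly_const_hom])

lemma transition_var: "transition n (poly_var i) = (if i = Suc n then 0 else poly_var i)"
  by (simp add: transition_def poly_var_def[of i] mon_eval_def
      coefficient_hom.poly_eval_single[OF poly_const_hom] coefficient_hom.hom_one[OF poly_const_hom])

lemma poly_var_power:
  "poly_var i ^ k = Poly_Mapping.single (Poly_Mapping.single i k) (1::'k::field)"
  by (induction k) (auto simp: poly_var_def mult_single single_add[symmetric])

lemma prod_single:
  "(\<Prod>i\<in>A. Poly_Mapping.single (f i) (1::'k::field)) = Poly_Mapping.single (\<Sum>i\<in>A. f i) 1"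
  by (induction A rule: infinite_finite_induct) (auto simp: mult_single)

lemma mon_eval_transition:
  "mon_eval (\<lambda>i. if i = Suc n then 0 else poly_var i) m =
    (if Poly_Mapping.lookup m (Suc n) = 0 then Poly_Mapping.single m (1::'k::field) else 0)"
proof (cases "Poly_Mapping.lookup m (Suc n) = 0")
  case True
  hence "mon_eval (\<lambda>i. if i = Suc n then 0 else poly_var i) m =
     (\<Prod>i\<in>Poly_Mapping.keys m. Poly_Mapping.single (Poly_Mapping.single i (Poly_Mapping.lookup m i)) (1::'k))"
    unfolding mon_eval_def by (intro prod.cong) (auto simp: in_keys_iff poly_var_power)
  also have "\<dots> = Poly_Mapping.single m 1"
    by (simp add: prod_single poly_mapping_sum_singles[symmetric])
  finally show ?thesis using True by simp
next
  case False
  hence "Suc n \<in> Poly_Mapping.keys m" by (simp add: in_keys_iff)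
  with False show ?thesis unfolding mon_eval_def
    by (auto intro!: prod_zero bexI[of _ "Suc n"])
qed

lemma lookup_transition:
  "Poly_Mapping.lookup (transition n p) m = (if Poly_Mapping.lookup m (Suc n) = 0 then Poly_Mapping.lookup p m else 0)"
proof -
  have "transition n p = (\<Sum>m\<in>Poly_Mapping.keys p. if Poly_Mapping.lookup m (Suc n) = 0
     then Poly_Mapping.single m (Poly_Mapping.lookup p m) else 0)"
    unfolding transition_def poly_eval_def mon_eval_transition
    by (intro sum.cong) (auto simp: poly_const_def mult_single)
  hence "Poly_Mapping.lookup (transition n p) m = (\<Sum>m'\<in>Poly_Mapping.keys p. if m' = m then
      (if Poly_Mapping.lookup m (Suc n) = 0 then Poly_Mapping.lookup p m else 0) else 0)"
    by (simp only: lookup_sum, intro sum.cong) (auto simp: lookup_single)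
  thus ?thesis by (simp add: in_keys_iff)
qed

lemma mdeg_zero [simp]: "mdeg 0 = 0"
  by (simp add: mdeg_def)

lemma mdeg_add: "mdeg (m + m') = mdeg m + mdeg m'"
proof -
  have *: "mdeg k = (\<Sum>i\<in>Poly_Mapping.keys m \<union> Poly_Mapping.keys m'. Poly_Mapping.lookup k i)" if "Poly_Mapping.keys k \<subseteq> Poly_Mapping.keys m \<union> Poly_Mapping.keys m'" for k
    unfolding mdeg_def by (rule sum.mono_neutral_left) (use that in \<open>auto simp: in_keys_iff\<close>)
  show ?thesis
    using *[of "m + m'"] *[of m] *[of m'] keys_add[of m m'] by (simp add: lookup_add sum.distrib)
qed

lemma mdeg_eq_0: "mdeg m = 0 \<longleftrightarrow> m = 0"
  by (auto simp: mdeg_def in_keys_iff intro!: poly_mapping_eqI)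

lemma poly_component_iff:
  "p \<in> poly_component n d \<longleftrightarrow> (\<forall>m. Poly_Mapping.lookup p m \<noteq> 0 \<longrightarrow> Poly_Mapping.keys m \<subseteq> {..n} \<and> mdeg m = d)"
  by (auto simp: poly_component_def in_keys_iff)

lemma transition_component:
  "p \<in> poly_component (Suc n) d \<Longrightarrow> transition n p \<in> poly_component n d"
  unfolding poly_component_iff
  by (auto simp: lookup_transition subset_iff in_keys_iff le_Suc_eq split: if_splits)
     (metis less_irrefl)


section \<open>The graded inverse limit as a ring\<close>

definition hom_part :: "nat \<Rightarrow> 'k::field mpoly \<Rightarrow> 'k mpoly" where
  "hom_part d p = Abs_poly_mapping (\<lambda>m. Poly_Mapping.lookup p m when mdeg m = d)"

lemma lookup_hom_part: "Poly_Mapping.lookup (hom_part d p) m = (Poly_Mapping.lookup p m when mdeg m = d)"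
proof -
  have "finite {m. (Poly_Mapping.lookup p m when mdeg m = d) \<noteq> 0}"
    by (rule finite_subset[OF _ finite_lookup[of p]]) auto
  thus ?thesis by (simp add: hom_part_def)
qed

lemma limit_carrier_iff:
  "f \<in> limit_carrier \<longleftrightarrow>
     (\<forall>n. transition n (f (Suc n)) = f n) \<and>
     (\<exists>D. \<forall>n m. Poly_Mapping.lookup (f n) m \<noteq> 0 \<longrightarrow> Poly_Mapping.keys m \<subseteq> {..n} \<and> mdeg m \<le> D)"
  (is "?L \<longleftrightarrow> ?R")
proof
  assume ?L
  then obtain D g where f: "f = (\<lambda>n. \<Sum>d\<le>D. g d n)" and g: "\<And>d. g d \<in> limit_component d"
    by (auto simp: limit_carrier_def)
  have "transition n (f (Suc n)) = f n" for n
    using g by (auto simp: f limit_component_def transition_def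
        coefficient_hom.poly_eval_sum[OF poly_const_hom])
  moreover have "Poly_Mapping.keys m \<subseteq> {..n} \<and> mdeg m \<le> D" if "Poly_Mapping.lookup (f n) m \<noteq> 0" for n m
  proof -
    from that obtain d where "d \<le> D" "Poly_Mapping.lookup (g d n) m \<noteq> 0"
      by (auto simp: f lookup_sum elim!: sum.not_neutral_contains_not_neutral)
    thus ?thesis using g[of d] by (auto simp: limit_component_def poly_component_iff)
  qed
  ultimately show ?R by blast
next
  assume ?R
  then obtain D where t: "\<And>n. transition n (f (Suc n)) = f n"
    and D: "\<And>n m. Poly_Mapping.lookup (f n) m \<noteq> 0 \<Longrightarrow> Poly_Mapping.keys m \<subseteq> {..n} \<and> mdeg m \<le> D" by blast
  have tl: "(if Poly_Mapping.lookup m (Suc n) = 0 then Poly_Mapping.lookup (f (Suc n)) m else 0) = Poly_Mapping.lookup (f n) m" for n m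
    using t[of n] lookup_transition by metis
  have "(\<lambda>n. hom_part d (f n)) \<in> limit_component d" for d
    unfolding limit_component_def poly_component_iff
  proof (intro CollectI allI conjI impI)
    fix n
    show "transition n (hom_part d (f (Suc n))) = hom_part d (f n)"
      by (rule poly_mapping_eqI)
         (simp add: lookup_transition lookup_hom_part tl[symmetric] when_def)
  next
    fix n m assume "Poly_Mapping.lookup (hom_part d (f n)) m \<noteq> 0"
    hence "Poly_Mapping.lookup (f n) m \<noteq> 0" "mdeg m = d" by (auto simp: lookup_hom_part)
    thus "Poly_Mapping.keys m \<subseteq> {..n}" "mdeg m = d" using D by auto
  qed
  moreover have "f = (\<lambda>n. \<Sum>d\<le>D. hom_part d (f n))"
  proof (intro ext poly_mapping_eqI)
    fix n m
    show "Poly_Mapping.lookup (f n) m = Poly_Mapping.lookup (\<Sum>d\<le>D. hom_part d (f n)) m"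
      using D[of n m] by (auto simp: lookup_sum lookup_hom_part when_def)
  qed
  ultimately show ?L unfolding limit_carrier_def
    by (intro CollectI exI[of _ D] exI[of _ "\<lambda>d n. hom_part d (f n)"]) auto
qed

lemma limit_component_carrier:
  "f \<in> limit_component d \<Longrightarrow> f \<in> limit_carrier"
  unfolding limit_carrier_iff limit_component_def poly_component_iff by auto

lemma limit_component_iff:
  "f \<in> limit_component d \<longleftrightarrow>
     f \<in> limit_carrier \<and> (\<forall>n m. Poly_Mapping.lookup (f n) m \<noteq> 0 \<longrightarrow> mdeg m = d)"
  unfolding limit_carrier_iff limit_component_def poly_component_iff mem_Collect_eq
  by (metis order_refl)

lemma limit_const: "(\<lambda>n. poly_const a) \<in> limit_component 0"
  unfolding limit_component_def poly_component_iff
  by (auto simp: transition_const) (auto simp: poly_const_def lookup_single when_def split: if_splits)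

lemma limit_zero: "(\<lambda>n. 0) \<in> limit_component d"
  by (auto simp: limit_component_def poly_component_def transition_def
      coefficient_hom.poly_eval_zero[OF poly_const_hom])

lemma limit_one: "(\<lambda>n. 1) \<in> limit_carrier"
  using limit_component_carrier[OF limit_const[of 1]] by (simp add: poly_const_def)

lemma limit_add:
  assumes "f \<in> limit_carrier" "g \<in> limit_carrier"
  shows "(\<lambda>n. f n + g n) \<in> limit_carrier"
proof -
  from assms obtain D E
    where D: "\<And>n m. Poly_Mapping.lookup (f n) m \<noteq> 0 \<Longrightarrow> Poly_Mapping.keys m \<subseteq> {..n} \<and> mdeg m \<le> D"
      and E: "\<And>n m. Poly_Mapping.lookup (g n) m \<noteq> 0 \<Longrightarrow> Poly_Mapping.keys m \<subseteq> {..n} \<and> mdeg m \<le> E"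
    unfolding limit_carrier_iff by blast
  have "Poly_Mapping.keys m \<subseteq> {..n} \<and> mdeg m \<le> max D E" if "Poly_Mapping.lookup (f n + g n) m \<noteq> 0" for n m
    using that D[of n m] E[of n m] by (cases "Poly_Mapping.lookup (f n) m = 0") (auto simp: lookup_add)
  thus ?thesis using assms unfolding limit_carrier_iff by (auto simp: transition_add)
qed

lemma limit_mult:
  assumes "f \<in> limit_carrier" "g \<in> limit_carrier"
  shows "(\<lambda>n. f n * g n) \<in> limit_carrier"
proof -
  from assms obtain D E
    where D: "\<And>n m. Poly_Mapping.lookup (f n) m \<noteq> 0 \<Longrightarrow> Poly_Mapping.keys m \<subseteq> {..n} \<and> mdeg m \<le> D"
      and E: "\<And>n m. Poly_Mapping.lookup (g n) m \<noteq> 0 \<Longrightarrow> Poly_Mapping.keys m \<subseteq> {..n} \<and> mdeg m \<le> E"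
    unfolding limit_carrier_iff by blast
  have "Poly_Mapping.keys m \<subseteq> {..n} \<and> mdeg m \<le> D + E" if nz: "Poly_Mapping.lookup (f n * g n) m \<noteq> 0" for n m
  proof -
    have "m \<in> Poly_Mapping.keys (f n * g n)" using nz by (simp add: in_keys_iff)
    then obtain a b where "m = a + b" "a \<in> Poly_Mapping.keys (f n)" "b \<in> Poly_Mapping.keys (g n)"
      using keys_mult by blast
    thus ?thesis using D[of n a] E[of n b] keys_add[of a b]
      by (auto simp: in_keys_iff mdeg_add)
  qed
  thus ?thesis using assms unfolding limit_carrier_iff by (auto simp: transition_mult)
qed

lemma limit_uminus:
  assumes "f \<in> limit_carrier"
  shows "(\<lambda>n. - f n) \<in> limit_carrier"
  using limit_mult[OF limit_component_carrier[OF limit_const[of "- 1"]] assms]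
  by (simp add: poly_const_def single_uminus)

typedef (overloaded) 'k graded_limit = "limit_carrier :: (nat \<Rightarrow> 'k::field mpoly) set"
  morphisms proj Abs_graded_limit
  using limit_one by blast

setup_lifting type_definition_graded_limit

instantiation graded_limit :: (field) comm_ring_1
begin

lift_definition zero_graded_limit :: "'a graded_limit" is "\<lambda>n. 0"
  by (rule limit_component_carrier[OF limit_zero])

lift_definition one_graded_limit :: "'a graded_limit" is "\<lambda>n. 1"
  by (rule limit_one)

lift_definition plus_graded_limit :: "'a graded_limit \<Rightarrow> 'a graded_limit \<Rightarrow> 'a graded_limit"
  is "\<lambda>f g n. f n + g n" by (rule limit_add)

lift_definition times_graded_limit :: "'a graded_limit \<Rightarrow> 'a graded_limit \<Rightarrow> 'a graded_limit"
  is "\<lambda>f g n. f n * g n" by (rule limit_mult)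

lift_definition uminus_graded_limit :: "'a graded_limit \<Rightarrow> 'a graded_limit"
  is "\<lambda>f n. - f n" by (rule limit_uminus)

lift_definition minus_graded_limit :: "'a graded_limit \<Rightarrow> 'a graded_limit \<Rightarrow> 'a graded_limit"
  is "\<lambda>f g n. f n - g n"
  using limit_add[OF _ limit_uminus] by fastforce

instance
  by standard (transfer; auto simp: algebra_simps fun_eq_iff)+

end

lift_definition limit_of_const :: "'k::field \<Rightarrow> 'k graded_limit" is "\<lambda>a n. poly_const a"
  by (rule limit_component_carrier[OF limit_const])

definition limit_grading :: "nat \<Rightarrow> 'k::field graded_limit set" where
  "limit_grading d = {r. proj r \<in> limit_component d}"


section \<open>Grading and universal property of the limit\<close>

lemma proj_simps:
  "proj 0 n = 0" "proj 1 n = 1" "proj (x + y) n = proj x n + proj y n"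
  "proj (x * y) n = proj x n * proj y n" "proj (- x) n = - proj x n"
  by (transfer; simp)+

lemma proj_sum: "proj (sum f A) n = (\<Sum>a\<in>A. proj (f a) n)"
  by (induction A rule: infinite_finite_induct) (auto simp: proj_simps)

lemma graded_limit_eqI: "(\<And>n m. Poly_Mapping.lookup (proj x n) m = Poly_Mapping.lookup (proj y n) m) \<Longrightarrow> x = y"
  by (metis ext poly_mapping_eqI proj_inject)

lemma limit_grading_iff:
  "x \<in> limit_grading d \<longleftrightarrow> (\<forall>n m. Poly_Mapping.lookup (proj x n) m \<noteq> 0 \<longrightarrow> mdeg m = d)"
  using proj[of x] by (auto simp: limit_grading_def limit_component_iff)

lemma lookup_graded_sum:
  assumes "\<forall>d. g d \<in> limit_grading d" "finite {d. g d \<noteq> 0}"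
  shows "Poly_Mapping.lookup (proj (\<Sum>d | g d \<noteq> 0. g d) n) m = Poly_Mapping.lookup (proj (g (mdeg m)) n) m"
proof -
  have "Poly_Mapping.lookup (proj (\<Sum>d | g d \<noteq> 0. g d) n) m = (\<Sum>d | g d \<noteq> 0. Poly_Mapping.lookup (proj (g d) n) m)"
    by (simp add: proj_sum lookup_sum)
  also have "\<dots> = (\<Sum>d\<in>{mdeg m}. Poly_Mapping.lookup (proj (g d) n) m)"
  proof (rule sum.mono_neutral_cong)
    fix d assume "d \<in> {d. g d \<noteq> 0} - {mdeg m}"
    moreover have "g d \<in> limit_grading d" using assms by blast
    ultimately show "Poly_Mapping.lookup (proj (g d) n) m = 0"
      unfolding limit_grading_iff by blast
  qed (use assms in \<open>auto simp: proj_simps\<close>)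
  finally show ?thesis by simp
qed

lemma limit_decomposition:
  fixes r :: "'k::field graded_limit"
  shows "\<exists>!g. (\<forall>d. g d \<in> limit_grading d) \<and> finite {d. g d \<noteq> 0} \<and> r = (\<Sum>d | g d \<noteq> 0. g d)"
proof (rule ex_ex1I)
  obtain D h where r: "proj r = (\<lambda>n. \<Sum>d\<le>D. h d n)" and h: "\<And>d. h d \<in> limit_component d"
    using proj[of r] by (auto simp: limit_carrier_def)
  define g where "g d = (if d \<le> D then Abs_graded_limit (h d) else 0)" for d
  have pg: "proj (g d) = h d" if "d \<le> D" for d
    using that limit_component_carrier[OF h[of d]] by (simp add: g_def Abs_graded_limit_inverse)
  have 1: "\<forall>d. g d \<in> limit_grading d"
  proof
    fix d show "g d \<in> limit_grading d"
    proof (cases "d \<le> D")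
      case True
      thus ?thesis using h[of d] pg[of d] by (simp add: limit_grading_def)
    next
      case False
      thus ?thesis by (simp add: g_def limit_grading_def zero_graded_limit.rep_eq limit_zero)
    qed
  qed
  have sub: "{d. g d \<noteq> 0} \<subseteq> {..D}" by (auto simp: g_def split: if_splits)
  hence 2: "finite {d. g d \<noteq> 0}" using finite_subset by blast
  have "(\<Sum>d | g d \<noteq> 0. g d) = (\<Sum>d\<le>D. g d)"
    by (rule sum.mono_neutral_left) (use sub in auto)
  also have "(\<Sum>d\<le>D. g d) = r"
    by (rule graded_limit_eqI) (simp add: proj_sum r pg)
  finally have 3: "r = (\<Sum>d | g d \<noteq> 0. g d)" by simp
  show "\<exists>g. (\<forall>d. g d \<in> limit_grading d) \<and> finite {d. g d \<noteq> 0} \<and>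
      r = (\<Sum>d | g d \<noteq> 0. g d)" using 1 2 3 by (intro exI[of _ g] conjI)
next
  fix g g' :: "nat \<Rightarrow> 'k graded_limit"
  assume g: "(\<forall>d. g d \<in> limit_grading d) \<and> finite {d. g d \<noteq> 0} \<and> r = (\<Sum>d | g d \<noteq> 0. g d)"
    and g': "(\<forall>d. g' d \<in> limit_grading d) \<and> finite {d. g' d \<noteq> 0} \<and> r = (\<Sum>d | g' d \<noteq> 0. g' d)"
  show "g = g'"
  proof (intro ext graded_limit_eqI)
    fix d n m
    show "Poly_Mapping.lookup (proj (g d) n) m = Poly_Mapping.lookup (proj (g' d) n) m"
    proof (cases "mdeg m = d")
      case True
      have "Poly_Mapping.lookup (proj r n) m = Poly_Mapping.lookup (proj (g d) n) m"
        using lookup_graded_sum[of g n m] g True by simp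
      moreover have "Poly_Mapping.lookup (proj r n) m = Poly_Mapping.lookup (proj (g' d) n) m"
        using lookup_graded_sum[of g' n m] g' True by simp
      ultimately show ?thesis by simp
    next
      case False
      hence "Poly_Mapping.lookup (proj (g d) n) m = 0" "Poly_Mapping.lookup (proj (g' d) n) m = 0"
        using g g' limit_grading_iff by blast+
      thus ?thesis by simp
    qed
  qed
qed

lemma graded_ring_limit: "graded_ring (limit_grading :: nat \<Rightarrow> 'k::field graded_limit set)"
proof
  fix d e and x y :: "'k graded_limit"
  show "0 \<in> (limit_grading d :: 'k graded_limit set)" by (simp add: limit_grading_iff proj_simps)
  show "x + y \<in> limit_grading d" if "x \<in> limit_grading d" "y \<in> limit_grading d"
    unfolding limit_grading_iff
  proof (intro allI impI)
    fix n m assume "Poly_Mapping.lookup (proj (x + y) n) m \<noteq> 0"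
    hence "Poly_Mapping.lookup (proj x n) m \<noteq> 0 \<or> Poly_Mapping.lookup (proj y n) m \<noteq> 0"
      by (auto simp: proj_simps lookup_add)
    thus "mdeg m = d" using that by (auto simp: limit_grading_iff)
  qed
  show "- x \<in> limit_grading d" if "x \<in> limit_grading d"
    using that by (simp add: limit_grading_iff proj_simps)
  show "1 \<in> (limit_grading 0 :: 'k graded_limit set)"
    by (auto simp: limit_grading_iff proj_simps lookup_one when_def)
  show "x * y \<in> limit_grading (d + e)" if "x \<in> limit_grading d" "y \<in> limit_grading e"
    unfolding limit_grading_iff proj_simps
  proof (intro allI impI)
    fix n m assume "Poly_Mapping.lookup (proj x n * proj y n) m \<noteq> 0"
    hence "m \<in> Poly_Mapping.keys (proj x n * proj y n)" by (simp add: in_keys_iff)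
    then obtain a b where "m = a + b" "a \<in> Poly_Mapping.keys (proj x n)" "b \<in> Poly_Mapping.keys (proj y n)"
      using keys_mult by blast
    thus "mdeg m = d + e" using that by (auto simp: limit_grading_iff mdeg_add in_keys_iff)
  qed
qed (rule limit_decomposition)

lemma connected_graded_algebra_limit:
  "connected_graded_algebra limit_of_const (limit_grading :: nat \<Rightarrow> 'k::field graded_limit set)"
proof -
  interpret graded_ring "limit_grading :: nat \<Rightarrow> 'k graded_limit set" by (rule graded_ring_limit)
  have "inj (limit_of_const :: 'k \<Rightarrow> _)"
  proof (rule injI)
    fix a b :: 'k assume "limit_of_const a = limit_of_const b"
    hence "proj (limit_of_const a) 0 = proj (limit_of_const b) 0" by simp
    hence "poly_const a = poly_const b" by (simp add: limit_of_const.rep_eq)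
    thus "a = b" by (metis poly_const_def lookup_single_eq)
  qed
  moreover have "limit_of_const ` UNIV = (limit_grading 0 :: 'k graded_limit set)"
  proof (intro equalityI subsetI)
    fix x :: "'k graded_limit" assume "x \<in> limit_of_const ` UNIV"
    thus "x \<in> limit_grading 0" by (auto simp: limit_grading_def limit_of_const.rep_eq limit_const)
  next
    fix x :: "'k graded_limit" assume x: "x \<in> limit_grading 0"
    have z: "Poly_Mapping.lookup (proj x n) m = 0" if "m \<noteq> 0" for n m
      using x that by (auto simp: limit_grading_iff mdeg_eq_0)
    have "transition n (proj x (Suc n)) = proj x n" for n
      using proj[of x] by (simp add: limit_carrier_iff)
    hence s: "Poly_Mapping.lookup (proj x (Suc n)) 0 = Poly_Mapping.lookup (proj x n) 0" for n
      using lookup_transition[of n "proj x (Suc n)" 0] by simp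
    define a where "a = Poly_Mapping.lookup (proj x 0) 0"
    have s': "Poly_Mapping.lookup (proj x n) 0 = a" for n
      by (induction n) (simp_all add: s a_def)
    have "x = limit_of_const a"
    proof (rule graded_limit_eqI)
      fix n m
      show "Poly_Mapping.lookup (proj x n) m = Poly_Mapping.lookup (proj (limit_of_const a) n) m"
        by (cases "m = 0") (simp_all add: limit_of_const.rep_eq poly_const_def lookup_single s' z)
    qed
    thus "x \<in> limit_of_const ` UNIV" by blast
  qed
  ultimately have "bij_betw limit_of_const UNIV (limit_grading 0 :: 'k graded_limit set)"
    by (simp add: bij_betw_def)
  thus ?thesis
    by unfold_locales
       (auto intro!: graded_limit_eqI simp: limit_of_const.rep_eq proj_simps poly_const_def
         single_add mult_single)
qed

lemma graded_hom_proj: "graded_hom limit_grading (poly_component n) (\<lambda>x. proj x n)"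
  by (simp add: graded_hom_def proj_simps limit_grading_def limit_component_def)

lemma transition_proj: "transition n (proj x (Suc n)) = proj x n"
  using proj[of x] by (simp add: limit_carrier_iff)

theorem limit_universal_property:
  fixes H :: "nat \<Rightarrow> 'b::comm_ring_1 set" and \<phi> :: "nat \<Rightarrow> 'b \<Rightarrow> 'k::field mpoly"
  assumes H: "graded_ring H"
    and hom: "\<And>n. graded_hom H (poly_component n) (\<phi> n)"
    and compat: "\<And>n b. transition n (\<phi> (Suc n) b) = \<phi> n b"
  shows "\<exists>!u. graded_hom H limit_grading u \<and> (\<forall>n b. proj (u b) n = \<phi> n b)"
proof (rule ex_ex1I)
  interpret H: graded_ring H by (rule H)
  have add: "\<phi> n (x + y) = \<phi> n x + \<phi> n y" for n x y
    using hom[of n] by (simp add: graded_hom_def)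
  have zero: "\<phi> n 0 = 0" for n using add[of n 0 0] by (metis add_cancel_right_right add_0)
  have sum: "\<phi> n (sum f A) = (\<Sum>a\<in>A. \<phi> n (f a))" for n and f :: "nat \<Rightarrow> 'b" and A
    by (induction A rule: infinite_finite_induct) (auto simp: zero add)
  have comp: "(\<lambda>n. \<phi> n b) \<in> limit_component d" if "b \<in> H d" for b d
    using that hom compat by (auto simp: limit_component_def graded_hom_def)
  have carrier: "(\<lambda>n. \<phi> n b) \<in> limit_carrier" for b
  proof -
    obtain g where g: "\<And>d. g d \<in> H d" "finite {d. g d \<noteq> 0}" "b = (\<Sum>d | g d \<noteq> 0. g d)"
      using H.direct_sum[of b] by blast
    obtain D where D: "{d. g d \<noteq> 0} \<subseteq> {..D}"
      using g(2) finite_nat_set_iff_bounded_le by (metis atMost_iff subsetI)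
    have "b = (\<Sum>d\<le>D. g d)"
      unfolding g(3) by (rule sum.mono_neutral_left) (use D in auto)
    hence "(\<lambda>n. \<phi> n b) = (\<lambda>n. \<Sum>d\<le>D. \<phi> n (g d))" by (simp add: sum)
    thus ?thesis unfolding limit_carrier_def using comp[OF g(1)]
      by (intro CollectI exI[of _ D] exI[of _ "\<lambda>d n. \<phi> n (g d)"]) auto
  qed
  define u where "u b = Abs_graded_limit (\<lambda>n. \<phi> n b)" for b
  have pu: "proj (u b) n = \<phi> n b" for b n
    by (simp add: u_def Abs_graded_limit_inverse carrier)
  hence pu': "proj (u b) = (\<lambda>n. \<phi> n b)" for b by auto
  have "graded_hom H limit_grading u"
    unfolding graded_hom_def
  proof (intro conjI allI ballI)
    show "u 1 = 1" using hom by (auto intro!: graded_limit_eqI simp: pu proj_simps graded_hom_def)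
    show "u (x + y) = u x + u y" for x y
      by (auto intro!: graded_limit_eqI simp: pu proj_simps add)
    show "u (x * y) = u x * u y" for x y
      using hom by (auto intro!: graded_limit_eqI simp: pu proj_simps graded_hom_def)
    show "u x \<in> limit_grading d" if "x \<in> H d" for x d
      using comp[OF that] by (simp add: limit_grading_def pu')
  qed
  thus "\<exists>u. graded_hom H limit_grading u \<and> (\<forall>n b. proj (u b) n = \<phi> n b)" using pu by blast
qed (auto intro!: graded_limit_eqI ext)

end

theory Submission
  imports Defs "HOL-Computational_Algebra.Polynomial" "HOL-Computational_Algebra.Primes"
begin

text \<open>
  Write \<open>R\<close> for the limit, whose elements are the formal combinations of monomials of bounded degree
  in \<open>x\<^sub>0, x\<^sub>1, \<dots>\<close>. Substituting \<open>x\<^sub>j + t\<close> for \<open>x\<^sub>j\<close> is a ring homomorphism \<open>R \<rightarrow> R[t]\<close>; its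
  coefficients are the Hasse derivatives of \<open>R\<close> in direction \<open>j\<close>. They lower degrees, and they see
  enough of \<open>R\<close>: a homogeneous element of positive degree with no nonzero derivative of positive
  order is zero, and in characteristic \<open>p\<close> the derivatives of a homogeneous element of positive
  degree decide whether it is a combination \<open>\<Sum>b\<in>B. b h\<^sub>b\<^sup>p\<close> for a given finite set \<open>B\<close> of scalars.
  The locale \<open>hasse_algebra\<close> records these properties, and \<open>polynomial_ring\<close> derives from them
  alone that a graded algebra is a polynomial ring.

  For each \<open>d > 0\<close> take as generators a basis of \<open>R\<^sub>d\<close> modulo what elements of lower degree generate.
  Induction on the degree shows that these elements generate \<open>R\<close>. Independence is proved by adjoining them one
  at a time: let \<open>A\<close> be a subalgebra that contains all elements of degree below \<open>d\<close> and is closed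
  under Hasse derivatives, and let \<open>u\<close> have degree \<open>d\<close> and lie outside \<open>A\<close>. Suppose that \<open>Q\<close> is a
  homogeneous relation \<open>Q(u) = 0\<close> over \<open>A\<close> of least degree, and expand
  \<open>Q(u + y) = \<Sum>i. b\<^sub>i y\<^sup>i\<close>. The derivatives of the \<open>b\<^sub>i\<close> are coefficients of the same
  kind for relations of smaller degree (\<open>coeff_T_translate\<close>), so they vanish. Hence only a constant
  \<open>b\<^sub>e = c\<close> survives and \<open>Q = c (y - u)\<^sup>e\<close>. The coefficient \<open>- e c u\<close> of \<open>Q\<close> lies in \<open>A\<close>
  and \<open>u\<close> does not, so \<open>e = 0\<close> in \<open>k\<close>. In characteristic zero this is absurd. In characteristic \<open>p\<close>
  it says that \<open>p\<close> divides \<open>e\<close>, and the constant coefficient shows that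
  \<open>c (u\<^bsup>e/p\<^esup>)\<^sup>p\<close> lies in \<open>A\<close>, up to sign.

  At this point \<open>A\<close> must be closed under extracting roots. Over a perfect field ordinary
  \<open>p\<close>-th roots would do, but in general \<open>c\<close> is not a \<open>p\<close>-th power, and the right condition is:
  if \<open>B\<close> is linearly independent over the field of \<open>p\<close>-th powers and \<open>\<Sum>b\<in>B. b g\<^sub>b\<^sup>p\<close> lies
  in \<open>A\<close>, then so does every \<open>g\<^sub>b\<close> (\<open>root_closed\<close>). It puts \<open>u\<^bsup>e/p\<^esup>\<close> into \<open>A\<close>,
  which is a relation of smaller degree than \<open>Q\<close>, a contradiction
  (\<open>weighted_relation_trivial\<close>). The condition has to survive the passage from \<open>A\<close> to \<open>A[u]\<close>;
  this is the main technical point, \<open>adjoin_roots\<close>, and the same expansion \<open>Q(u + y)\<close> proves it.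
\<close>

section \<open>Polynomials under translation and under Taylor homomorphisms\<close>

definition translate :: "'a::comm_ring_1 \<Rightarrow> 'a poly \<Rightarrow> 'a poly" where
  "translate u Q = pcompose Q [:u, 1:]"

lemma translate_0 [simp]: "translate u 0 = 0"
  by (simp add: translate_def)

lemma coeff_translate_pCons:
  "coeff (translate u (pCons a Q)) i =
     (case i of 0 \<Rightarrow> a + u * coeff (translate u Q) 0
        | Suc i' \<Rightarrow> u * coeff (translate u Q) (Suc i') + coeff (translate u Q) i')"
  by (auto simp: translate_def pcompose_pCons split: nat.splits)

lemma coeff_translate_0: "coeff (translate u Q) 0 = poly Q u"
  by (induction Q) (auto simp: coeff_translate_pCons)

lemma poly_translate_uminus: "poly (translate u Q) (- u) = coeff Q 0"
  by (simp add: translate_def poly_pcompose poly_0_coeff_0)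

lemma translate_uminus: "translate (- u) (translate u Q) = Q"
  by (simp add: translate_def pcompose_assoc[symmetric] pcompose_pCons)

lemma degree_translate_le: "degree (translate u Q) \<le> degree Q"
  using degree_pcompose_le[of Q "[:u, 1:]"] by (simp add: translate_def)

lemma coeff_translate_high:
  assumes "degree Q \<le> e"
  shows "coeff (translate u Q) e = coeff Q e"
  using assms
proof (induction Q arbitrary: e)
  case (pCons a Q)
  show ?case
  proof (cases e)
    case 0
    with pCons have "Q = 0" by (auto split: if_splits)
    thus ?thesis using 0 by (simp add: coeff_translate_pCons)
  next
    case (Suc e')
    hence le: "degree Q \<le> e'" using pCons.prems by (auto split: if_splits)
    moreover have "coeff (translate u Q) (Suc e') = 0"
      using le degree_translate_le[of u Q] by (intro coeff_eq_0) simp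
    ultimately show ?thesis using Suc pCons.IH[of e'] by (simp add: coeff_translate_pCons)
  qed
qed simp

text \<open>The two highest coefficients are all that the arguments below need of the binomial
  expansion of a translate.\<close>

lemma coeff_translate_next_to_high:
  assumes "degree Q \<le> Suc e"
  shows "coeff (translate u Q) e = coeff Q e + of_nat (Suc e) * coeff Q (Suc e) * u"
  using assms
proof (induction Q arbitrary: e)
  case (pCons a Q)
  hence le: "degree Q \<le> e" by (auto split: if_splits)
  have h: "coeff (translate u Q) e = coeff Q e" by (rule coeff_translate_high[OF le])
  show ?case
  proof (cases e)
    case 0
    thus ?thesis using h by (simp add: coeff_translate_pCons mult.commute)
  next
    case (Suc e')
    thus ?thesis using h pCons.IH[of e'] le by (simp add: coeff_translate_pCons algebra_simps)
  qed
qed simp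

lemma translate_sum: "translate u (sum f B) = (\<Sum>b\<in>B. translate u (f b))"
  by (simp add: translate_def pcompose_sum)

lemma translate_smult: "translate u (smult a Q) = smult a (translate u Q)"
  by (simp add: translate_def pcompose_smult)

lemma translate_power: "translate u (Q ^ n) = translate u Q ^ n"
  by (induction n) (auto simp: translate_def pcompose_mult pcompose_1)


text \<open>Only closure under sums and products and the behaviour of degrees matter for the bookkeeping,
  and integer degrees avoid truncated subtraction. Constant families are allowed, so the same
  lemmas also say that coefficients stay inside a given subring.\<close>

locale int_graded_family =
  fixes H :: "int \<Rightarrow> 'r::comm_ring_1 set"
  assumes zero_H: "0 \<in> H n"
    and add_H: "x \<in> H n \<Longrightarrow> y \<in> H n \<Longrightarrow> x + y \<in> H n"
    and mult_H: "x \<in> H m \<Longrightarrow> y \<in> H n \<Longrightarrow> x * y \<in> H (m + n)"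
begin

lemma sum_H: "(\<And>i. i \<in> I \<Longrightarrow> f i \<in> H n) \<Longrightarrow> sum f I \<in> H n"
  by (induction I rule: infinite_finite_induct) (auto simp: zero_H add_H)

definition weighted :: "nat \<Rightarrow> int \<Rightarrow> 'r poly \<Rightarrow> bool" where
  "weighted d N Q \<longleftrightarrow> (\<forall>i. coeff Q i \<in> H (N - int (d * i)))"

lemma weighted_pConsD:
  assumes "weighted d N (pCons a Q)"
  shows "a \<in> H N" "weighted d (N - int d) Q"
proof -
  show "a \<in> H N" using assms[unfolded weighted_def, rule_format, of 0] by simp
  show "weighted d (N - int d) Q"
    unfolding weighted_def
  proof
    fix i show "coeff Q i \<in> H (N - int d - int (d * i))"
      using assms[unfolded weighted_def, rule_format, of "Suc i"] by (simp add: algebra_simps)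
  qed
qed

lemma weighted_translate:
  assumes u: "u \<in> H (int d)" and "weighted d N Q"
  shows "weighted d N (translate u Q)"
  using assms(2)
proof (induction Q arbitrary: N)
  case 0
  thus ?case by (simp add: weighted_def)
next
  case (pCons a Q)
  note aQ = weighted_pConsD[OF pCons.prems]
  have IH: "coeff (translate u Q) i \<in> H (N - int d - int (d * i))" for i
    using pCons.IH[OF aQ(2)] by (simp add: weighted_def)
  have uIH: "u * coeff (translate u Q) i \<in> H (N - int (d * i))" for i
    using mult_H[OF u IH[of i]] by simp
  show ?case unfolding weighted_def
  proof
    fix i
    show "coeff (translate u (pCons a Q)) i \<in> H (N - int (d * i))"
    proof (cases i)
      case 0
      thus ?thesis using add_H[OF aQ(1)] uIH[of 0] by (simp add: coeff_translate_pCons)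
    next
      case (Suc i')
      thus ?thesis using uIH[of i] IH[of i']
        by (auto simp: coeff_translate_pCons algebra_simps intro!: add_H)
    qed
  qed
qed

end

text \<open>A ring homomorphism \<open>T x = (\<Sum>r. D\<^sub>r x t^r)\<close> to the polynomial ring encodes a
  sequence of operators \<open>D\<^sub>r\<close> satisfying the Leibniz rule of Hasse derivatives.\<close>

locale taylor_hom =
  fixes T :: "'r::comm_ring_1 \<Rightarrow> 'r poly"
  assumes T_add: "T (x + y) = T x + T y"
    and T_mult: "T (x * y) = T x * T y"
begin

lemma T_zero [simp]: "T 0 = 0"
  using T_add[of 0 0] by simp

text \<open>If \<open>T\<close> is applied to the coefficients of \<open>Q\<close>, then \<open>T (Q(u))\<close> is the value of the result
  at \<open>T u\<close>, which differs from \<open>u\<close> by an element with coefficients of lower degree. Moving this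
  difference into the polynomial gives \<open>shifted\<close>, to be evaluated at \<open>u\<close> itself; its parts
  \<open>lifted\<close> with respect to the variable of \<open>T\<close> have coefficients in every subring that contains
  those of \<open>Q\<close> and the coefficients of this difference, and is closed under the coefficients of \<open>T\<close>.\<close>

definition shifted :: "'r \<Rightarrow> 'r poly \<Rightarrow> 'r poly poly" where
  "shifted u Q = translate (T u - [:u:]) (map_poly T Q)"

definition lifted :: "'r \<Rightarrow> nat \<Rightarrow> 'r poly \<Rightarrow> 'r poly" where
  "lifted u r Q = map_poly (\<lambda>a. coeff a r) (shifted u Q)"

lemma map_poly_T_translate: "map_poly T (translate u Q) = translate (T u) (map_poly T Q)"
proof (induction Q)
  case (pCons a Q)
  have "coeff (map_poly T (translate u (pCons a Q))) i = coeff (translate (T u) (map_poly T (pCons a Q))) i" for i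
  proof -
    have "coeff (translate (T u) (map_poly T Q)) i = T (coeff (translate u Q) i)" for i
      using arg_cong[OF pCons.IH, of "\<lambda>P. coeff P i"] by (simp add: coeff_map_poly)
    thus ?thesis
      by (auto simp: coeff_map_poly map_poly_pCons coeff_translate_pCons T_add T_mult split: nat.splits)
  qed
  thus ?case by (rule poly_eqI)
qed simp

lemma map_poly_coeff_translate:
  "map_poly (\<lambda>a. coeff a r) (translate [:u:] Z) = translate u (map_poly (\<lambda>a. coeff a r) Z)"
proof (induction Z)
  case (pCons a Z)
  have "coeff (map_poly (\<lambda>a. coeff a r) (translate [:u:] (pCons a Z))) i
     = coeff (translate u (map_poly (\<lambda>a. coeff a r) (pCons a Z))) i" for i
  proof -
    have "coeff (translate u (map_poly (\<lambda>a. coeff a r) Z)) i = coeff (coeff (translate [:u:] Z) i) r" for i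
      using arg_cong[OF pCons.IH, of "\<lambda>P. coeff P i"] by (simp add: coeff_map_poly)
    thus ?thesis
      by (auto simp: coeff_map_poly map_poly_pCons coeff_translate_pCons split: nat.splits)
  qed
  thus ?case by (rule poly_eqI)
qed simp

text \<open>Hasse derivatives with respect to the formal variable commute with \<open>T\<close>, because both operations are
  translations: expanding at \<open>u\<close> and then applying \<open>T\<close>, or lifting first and expanding afterwards,
  are both the expansion at \<open>T u\<close>.\<close>

lemma coeff_T_translate:
  "coeff (T (coeff (translate u Q) i)) r = coeff (translate u (lifted u r Q)) i"
proof -
  have "translate [:u:] (shifted u Q) = translate (T u) (map_poly T Q)"
    by (simp add: shifted_def translate_def pcompose_assoc[symmetric] pcompose_pCons)
  hence "map_poly T (translate u Q) = translate [:u:] (shifted u Q)"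
    by (simp add: map_poly_T_translate)
  hence "map_poly (\<lambda>a. coeff a r) (map_poly T (translate u Q)) = translate u (lifted u r Q)"
    by (simp add: map_poly_coeff_translate lifted_def)
  from arg_cong[OF this, of "\<lambda>P. coeff P i"] show ?thesis by (simp add: coeff_map_poly)
qed

lemma coeff_T_poly: "coeff (T (poly Q u)) r = poly (lifted u r Q) u"
  using coeff_T_translate[of u Q 0 r] by (simp add: coeff_translate_0)

lemma weighted_lifted:
  assumes "int_graded_family H"
    and H: "\<And>x n r. x \<in> H n \<Longrightarrow> coeff (T x) r \<in> H (n - int r)"
    and u: "coeff (T u) 0 = u" "\<And>r. r > 0 \<Longrightarrow> coeff (T u) r \<in> H (int d - int r)"
    and "int_graded_family.weighted H d N Q"
  shows "int_graded_family.weighted H d (N - int r) (lifted u r Q)"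
proof -
  interpret int_graded_family H by fact
  have d: "coeff (T u - [:u:]) k \<in> H (int d - int k)" for k
    using u(1) u(2)[of k] by (cases k) (auto simp: zero_H)
  have "\<forall>i r. coeff (coeff (shifted u Q) i) r \<in> H (N - int (d * i) - int r)"
    using assms(5)
  proof (induction Q arbitrary: N)
    case 0
    thus ?case by (simp add: shifted_def zero_H)
  next
    case (pCons a Q)
    note aQ = weighted_pConsD[OF pCons.prems]
    have IH: "coeff (coeff (shifted u Q) i) r \<in> H (N - int d - int (d * i) - int r)" for i r
      using pCons.IH[OF aQ(2)] by blast
    have uIH: "coeff ((T u - [:u:]) * coeff (shifted u Q) i) r \<in> H (N - int (d * i) - int r)" for i r
      unfolding coeff_mult
    proof (rule sum_H)
      fix k assume "k \<in> {..r}"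
      hence eq: "int d - int k + (N - int d - int (d * i) - int (r - k)) = N - int (d * i) - int r"
        by simp
      show "coeff (T u - [:u:]) k * coeff (coeff (shifted u Q) i) (r - k) \<in> H (N - int (d * i) - int r)"
        using mult_H[OF d[of k] IH[of i "r - k"]] unfolding eq .
    qed
    show ?case
    proof (intro allI)
      fix i r
      have *: "coeff (shifted u (pCons a Q)) i = (case i of 0 \<Rightarrow> T a + (T u - [:u:]) * coeff (shifted u Q) 0
        | Suc i' \<Rightarrow> (T u - [:u:]) * coeff (shifted u Q) (Suc i') + coeff (shifted u Q) i')"
        by (simp add: shifted_def map_poly_pCons coeff_translate_pCons split: nat.split)
      show "coeff (coeff (shifted u (pCons a Q)) i) r \<in> H (N - int (d * i) - int r)"
      proof (cases i)
        case 0
        thus ?thesis unfolding * using add_H[OF H[OF aQ(1), of r] uIH[of 0 r, simplified]] by simp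
      next
        case (Suc i')
        have eq: "N - int d - int (d * i') - int r = N - int (d * i) - int r"
          by (simp add: Suc algebra_simps)
        have "coeff (coeff (shifted u Q) i') r \<in> H (N - int (d * i) - int r)"
          using IH[of i' r] unfolding eq .
        from add_H[OF uIH[of i r] this] show ?thesis unfolding * by (simp add: Suc)
      qed
    qed
  qed
  thus ?thesis by (simp add: weighted_def lifted_def coeff_map_poly algebra_simps)
qed

end


section \<open>Graded algebras with Taylor homomorphisms\<close>

lemma (in graded_ring) sum_mem: "(\<And>i. i \<in> I \<Longrightarrow> f i \<in> G d) \<Longrightarrow> sum f I \<in> G d"
  by (induction I rule: infinite_finite_induct) (auto simp: zero_mem add_mem)

lemma (in graded_ring) power_mem: "x \<in> G d \<Longrightarrow> x ^ n \<in> G (d * n)"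
proof (induction n)
  case (Suc n)
  thus ?case using mult_mem[of x d "x ^ n" "d * n"] by simp
qed (simp add: one_mem)

definition (in graded_ring) component :: "nat \<Rightarrow> 'r \<Rightarrow> 'r" where
  "component n x = (THE g. (\<forall>d. g d \<in> G d) \<and> finite {d. g d \<noteq> 0} \<and> x = (\<Sum>d | g d \<noteq> 0. g d)) n"

context graded_ring
begin

lemma component_props:
  "component n x \<in> G n" "finite {n. component n x \<noteq> 0}" "x = (\<Sum>n | component n x \<noteq> 0. component n x)"
  using theI'[OF direct_sum[of x]] by (auto simp: component_def)

lemma component_eqI:
  assumes "finite F" "\<And>n. g n \<in> G n" "\<And>n. n \<notin> F \<Longrightarrow> g n = 0" "x = (\<Sum>n\<in>F. g n)"
  shows "component n x = g n"
proof -
  have sub: "{n. g n \<noteq> 0} \<subseteq> F" using assms(3) by blast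
  have "x = (\<Sum>n | g n \<noteq> 0. g n)"
    unfolding assms(4) by (rule sum.mono_neutral_right) (use assms(1) sub in auto)
  hence "(\<forall>d. g d \<in> G d) \<and> finite {d. g d \<noteq> 0} \<and> x = (\<Sum>d | g d \<noteq> 0. g d)"
    using assms(2) finite_subset[OF sub assms(1)] by blast
  from the1_equality[OF direct_sum[of x], OF this] show ?thesis by (simp add: component_def)
qed

lemma component_hom: "x \<in> G n \<Longrightarrow> component m x = (if m = n then x else 0)"
  by (rule component_eqI[of "{n}"]) (auto simp: zero_mem)

lemma component_zero [simp]: "component n 0 = 0"
  using component_hom[OF zero_mem[of n], of n] by simp

lemma component_add: "component n (x + y) = component n x + component n y"
proof (rule component_eqI)
  let ?F = "{n. component n x \<noteq> 0} \<union> {n. component n y \<noteq> 0}"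
  show "finite ?F" using component_props(2) by blast
  have "x = (\<Sum>n\<in>?F. component n x)"
    by (rule trans[OF component_props(3) sum.mono_neutral_left]) (auto simp: component_props)
  moreover have "y = (\<Sum>n\<in>?F. component n y)"
    by (rule trans[OF component_props(3) sum.mono_neutral_left]) (auto simp: component_props)
  ultimately show "x + y = (\<Sum>n\<in>?F. component n x + component n y)" by (simp add: sum.distrib)
qed (auto intro: add_mem component_props)

lemma component_sum: "component n (sum f I) = (\<Sum>i\<in>I. component n (f i))"
  by (induction I rule: infinite_finite_induct) (auto simp: component_add)

lemma component_mult_hom:
  assumes "y \<in> G d"
  shows "component n (x * y) = (if d \<le> n then component (n - d) x * y else 0)"
proof (rule component_eqI)
  let ?F = "{n. component n x \<noteq> 0}"
  show "finite ((\<lambda>n. n + d) ` ?F)" using component_props(2) by blast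
  show "(if d \<le> n then component (n - d) x * y else 0) \<in> G n" for n
    using mult_mem[OF component_props(1)[of "n - d" x] assms] by (auto simp: zero_mem)
  show "(if d \<le> n then component (n - d) x * y else 0) = 0" if "n \<notin> (\<lambda>n. n + d) ` ?F" for n
    using that by (auto simp: image_iff) (metis le_add_diff_inverse2 mult_zero_left)
  have "x * y = (\<Sum>n\<in>?F. component n x * y)"
    by (subst component_props(3)[of x]) (simp add: sum_distrib_right)
  also have "\<dots> = (\<Sum>n\<in>(\<lambda>n. n + d) ` ?F. if d \<le> n then component (n - d) x * y else 0)"
    by (subst sum.reindex) (auto simp: inj_on_def)
  finally show "x * y = (\<Sum>n\<in>(\<lambda>n. n + d) ` ?F. if d \<le> n then component (n - d) x * y else 0)" .
qed

lemma component_all_zero: "(\<And>n. component n x = 0) \<Longrightarrow> x = 0"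
  by (subst component_props(3)) simp

end

text \<open>Linear independence over the subfield of \<open>p\<close>-th powers, where \<open>p > 0\<close> is the
  characteristic of \<open>k\<close>.\<close>

definition frobenius_independent :: "'k::field set \<Rightarrow> bool" where
  "frobenius_independent B \<longleftrightarrow>
     (\<forall>\<gamma>. (\<Sum>b\<in>B. b * \<gamma> b ^ CHAR('k)) = 0 \<longrightarrow> (\<forall>b\<in>B. \<gamma> b = 0))"

lemma frobenius_independent_extend:
  fixes B :: "'k::field set"
  assumes p: "prime CHAR('k)" and B: "finite B" "frobenius_independent B"
  obtains B' \<gamma> where "finite B'" "frobenius_independent B'" "B \<subseteq> B'"
    "x = (\<Sum>b\<in>B'. b * \<gamma> b ^ CHAR('k))"
proof (cases "\<exists>\<gamma>. x = (\<Sum>b\<in>B. b * \<gamma> b ^ CHAR('k))")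
  case True
  thus ?thesis using that[of B] B by blast
next
  case False
  let ?p = "CHAR('k)"
  have p0: "?p > 0" using p prime_gt_0_nat by blast
  have "x \<notin> B"
  proof
    assume "x \<in> B"
    hence "x = (\<Sum>b\<in>B. b * (if b = x then 1 else 0) ^ ?p)"
      using B p0 by (subst sum.remove[of _ x]) (auto intro!: sum.neutral)
    hence "\<exists>\<gamma>. x = (\<Sum>b\<in>B. b * \<gamma> b ^ ?p)" by (rule exI[where x = "\<lambda>b. if b = x then 1 else 0"])
    with False show False by contradiction
  qed
  have "frobenius_independent (insert x B)"
    unfolding frobenius_independent_def
  proof (intro allI impI)
    fix \<gamma> assume "(\<Sum>b\<in>insert x B. b * \<gamma> b ^ ?p) = 0"
    hence s: "x * \<gamma> x ^ ?p + (\<Sum>b\<in>B. b * \<gamma> b ^ ?p) = 0"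
      using B \<open>x \<notin> B\<close> by simp
    have "\<gamma> x = 0"
    proof (rule ccontr)
      assume nz: "\<gamma> x \<noteq> 0"
      have "(\<Sum>b\<in>B. b * (- \<gamma> b / \<gamma> x) ^ ?p) = (\<Sum>b\<in>B. - (b * \<gamma> b ^ ?p) / \<gamma> x ^ ?p)"
        by (intro sum.cong refl) (simp add: power_divide minus_power_prime_CHAR[OF refl p])
      also have "\<dots> = - (\<Sum>b\<in>B. b * \<gamma> b ^ ?p) / \<gamma> x ^ ?p"
        by (simp add: sum_negf sum_divide_distrib[symmetric])
      also have "\<dots> = x"
      proof -
        have "- (\<Sum>b\<in>B. b * \<gamma> b ^ ?p) = x * \<gamma> x ^ ?p" using s by (simp add: add_eq_0_iff)
        thus ?thesis using nz by simp
      qed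
      finally have "\<exists>\<gamma>. x = (\<Sum>b\<in>B. b * \<gamma> b ^ ?p)"
        by (intro exI[where x = "\<lambda>b. - \<gamma> b / \<gamma> x"]) simp
      with False show False by contradiction
    qed
    thus "\<forall>b\<in>insert x B. \<gamma> b = 0"
      using s B p0 unfolding frobenius_independent_def by (auto simp: power_0_left)
  qed
  moreover have "x = (\<Sum>b\<in>insert x B. b * (if b = x then 1 else 0) ^ ?p)"
    using B p0 \<open>x \<notin> B\<close> by (subst sum.remove[of _ x]) (auto intro!: sum.neutral)
  ultimately show ?thesis using that[of "insert x B" "\<lambda>b. if b = x then 1 else 0"] B by blast
qed

text \<open>\<open>coeff (T j x) r\<close> is the Hasse derivative of \<open>x\<close> of order \<open>r\<close> in direction \<open>j\<close>. The
  conclusion of \<open>T_roots\<close> is what the derivatives of \<open>\<Sum>b\<in>B. b h\<^sub>b\<^sup>p\<close> suggest: those of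
  order prime to \<open>p\<close> vanish, and the one of order \<open>p r\<close> is the same combination of the \<open>p\<close>-th
  powers of the derivatives of the \<open>h\<^sub>b\<close> of order \<open>r\<close>. The element is required to have degree
  \<open>p M\<close> with \<open>M > 0\<close>, since derivatives carry no information about constants.\<close>

locale hasse_algebra = connected_graded_algebra c G
  for c :: "'k::field \<Rightarrow> 'r::comm_ring_1" and G :: "nat \<Rightarrow> 'r set" +
  fixes T :: "'j \<Rightarrow> 'r \<Rightarrow> 'r poly"
  assumes taylor: "taylor_hom (T j)"
    and T_const: "T j (c a) = [:c a:]"
    and T_0: "coeff (T j x) 0 = x"
    and T_degree: "x \<in> G n \<Longrightarrow> r \<le> n \<Longrightarrow> coeff (T j x) r \<in> G (n - r)"
    and T_degree_high: "x \<in> G n \<Longrightarrow> r > n \<Longrightarrow> coeff (T j x) r = 0"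
    and T_detects: "x \<in> G n \<Longrightarrow> n > 0 \<Longrightarrow> (\<And>j r. r > 0 \<Longrightarrow> coeff (T j x) r = 0) \<Longrightarrow> x = 0"
    and T_roots: "prime CHAR('k) \<Longrightarrow> finite B \<Longrightarrow> M > 0 \<Longrightarrow> x \<in> G (CHAR('k) * M) \<Longrightarrow>
      (\<And>j r. \<not> CHAR('k) dvd r \<Longrightarrow> coeff (T j x) r = 0) \<Longrightarrow>
      (\<And>j r. r > 0 \<Longrightarrow> \<exists>h. coeff (T j x) (CHAR('k) * r) = (\<Sum>b\<in>B. c b * h b ^ CHAR('k))) \<Longrightarrow>
      \<exists>h. (\<forall>b\<in>B. h b \<in> G M) \<and> x = (\<Sum>b\<in>B. c b * h b ^ CHAR('k))"
begin

sublocale T: taylor_hom "T j" for j by (rule taylor)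

sublocale c: coefficient_hom c
  by unfold_locales (auto simp: c_one c_add c_mult)

lemma c_eq_0: "c a = 0 \<longleftrightarrow> a = 0"
  using c_bij c.hom_zero by (metis bij_betw_imp_inj_on injD)

lemma c_mem: "c a \<in> G 0"
  using c_bij by (auto simp: bij_betw_def)

lemma G0_E:
  assumes "x \<in> G 0" obtains a where "x = c a"
  using assms c_bij by (auto simp: bij_betw_def)

lemma c_of_nat: "c (of_nat n) = of_nat n"
  by (induction n) (auto simp: c.hom_zero c_add c_one)

lemma c_uminus: "c (- a) = - c a"
  by (metis add.right_inverse c.hom_zero c_add neg_eq_iff_add_eq_0)

lemma c_power: "c (a ^ n) = c a ^ n"
  by (induction n) (auto simp: c_one c_mult)

lemma c_sum: "c (sum f I) = (\<Sum>i\<in>I. c (f i))"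
  by (induction I rule: infinite_finite_induct) (auto simp: c.hom_zero c_add)

lemma CHAR_eq: "CHAR('r) = CHAR('k)"
proof -
  have "CHAR('r) dvd n \<longleftrightarrow> CHAR('k) dvd n" for n
    by (metis c_eq_0 c_of_nat of_nat_eq_0_iff_char_dvd)
  thus ?thesis by (metis dvd_antisym dvd_refl)
qed

lemma frobenius_add: "prime CHAR('k) \<Longrightarrow> (x + y :: 'r) ^ CHAR('k) = x ^ CHAR('k) + y ^ CHAR('k)"
  by (rule freshmans_dream) (auto simp: CHAR_eq)

lemma frobenius_sum: "prime CHAR('k) \<Longrightarrow> (sum f I :: 'r) ^ CHAR('k) = (\<Sum>i\<in>I. f i ^ CHAR('k))"
  by (rule freshmans_dream_sum) (auto simp: CHAR_eq)

lemma coeff_frobenius: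
  fixes P :: "'r poly"
  assumes "prime CHAR('k)"
  shows "coeff (P ^ CHAR('k)) i =
    (if CHAR('k) dvd i then coeff P (i div CHAR('k)) ^ CHAR('k) else 0)"
proof -
  let ?p = "CHAR('k)"
  have p0: "?p > 0" using assms prime_gt_0_nat by blast
  have mp: "monom a n ^ k = monom (a ^ k) (n * k)" for a :: 'r and n k
    by (induction k) (auto simp: mult_monom monom_0 one_pCons)
  have "P ^ ?p = (\<Sum>k\<le>degree P. monom (coeff P k) k) ^ ?p"
    by (simp add: poly_as_sum_of_monoms)
  also have "\<dots> = (\<Sum>k\<le>degree P. monom (coeff P k) k ^ ?p)"
    by (rule freshmans_dream_sum) (use assms in \<open>auto simp: CHAR_eq\<close>)
  also have "\<dots> = (\<Sum>k\<le>degree P. monom (coeff P k ^ ?p) (k * ?p))"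
    by (simp add: mp)
  finally have "coeff (P ^ ?p) i = (\<Sum>k\<le>degree P. if k * ?p = i then coeff P k ^ ?p else 0)"
    by (simp add: coeff_sum)
  also have "\<dots> = (if ?p dvd i then coeff P (i div ?p) ^ ?p else 0)"
  proof (cases "?p dvd i")
    case True
    then obtain m where i: "i = m * ?p" by (metis dvd_def mult.commute)
    have "(\<Sum>k\<le>degree P. if k * ?p = i then coeff P k ^ ?p else 0)
      = (\<Sum>k\<le>degree P. if k = m then coeff P k ^ ?p else 0)"
      using p0 by (intro sum.cong) (auto simp: i)
    also have "\<dots> = coeff P m ^ ?p"
      using p0 by (auto simp: sum.delta coeff_eq_0 power_0_left)
    finally show ?thesis using i p0 by simp
  qed (auto intro!: sum.neutral)
  finally show ?thesis .
qed

lemma T_frobenius_sum: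
  assumes "prime CHAR('k)"
  shows "coeff (T j (\<Sum>b\<in>B. c b * g b ^ CHAR('k))) r =
    (if CHAR('k) dvd r then \<Sum>b\<in>B. c b * coeff (T j (g b)) (r div CHAR('k)) ^ CHAR('k) else 0)"
proof -
  have T_pow: "T j (x ^ n) = T j x ^ n" for x n
    using T_const[of j 1] by (induction n) (auto simp: c_one one_pCons T.T_mult)
  have "T j (\<Sum>b\<in>B. c b * g b ^ CHAR('k)) = (\<Sum>b\<in>B. smult (c b) (T j (g b) ^ CHAR('k)))"
    by (induction B rule: infinite_finite_induct) (auto simp: T.T_add T.T_mult T_const T_pow)
  thus ?thesis by (simp add: coeff_sum coeff_frobenius[OF assms])
qed

definition Gz :: "int \<Rightarrow> 'r set" where
  "Gz n = (if n < 0 then {0} else G (nat n))"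

lemma Gz_of_nat [simp]: "Gz (int n) = G n"
  by (simp add: Gz_def)

sublocale full: int_graded_family Gz
proof
  fix x y and m n :: int
  show "0 \<in> Gz n" by (simp add: Gz_def zero_mem)
  show "x + y \<in> Gz n" if "x \<in> Gz n" "y \<in> Gz n"
    using that by (auto simp: Gz_def add_mem split: if_splits)
  show "x * y \<in> Gz (m + n)" if "x \<in> Gz m" "y \<in> Gz n"
  proof (cases "m < 0 \<or> n < 0")
    case True
    thus ?thesis using that by (auto simp: Gz_def zero_mem)
  next
    case False
    thus ?thesis using that mult_mem[of x "nat m" y "nat n"] by (auto simp: Gz_def nat_add_distrib)
  qed
qed

lemma T_Gz: "x \<in> Gz n \<Longrightarrow> coeff (T j x) r \<in> Gz (n - int r)"
proof (cases "n < 0")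
  case True
  moreover assume "x \<in> Gz n"
  ultimately show ?thesis by (simp add: Gz_def)
next
  case False
  assume "x \<in> Gz n"
  hence "x \<in> G (nat n)" using False by (simp add: Gz_def)
  thus ?thesis using T_degree[of x "nat n" r j] T_degree_high[of x "nat n" r j] False
    by (auto simp: Gz_def nat_diff_distrib zero_mem not_le)
qed

text \<open>In characteristic zero the condition is empty, so that both cases can be treated together.\<close>

definition root_closed :: "'r set \<Rightarrow> bool" where
  "root_closed A \<longleftrightarrow> (prime CHAR('k) \<longrightarrow>
     (\<forall>B M g. finite B \<longrightarrow> frobenius_independent B \<longrightarrow> (\<forall>b\<in>B. g b \<in> G M) \<longrightarrow>
        (\<Sum>b\<in>B. c b * g b ^ CHAR('k)) \<in> A \<longrightarrow> (\<forall>b\<in>B. g b \<in> A)))"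

lemma root_closedD:
  "root_closed A \<Longrightarrow> prime CHAR('k) \<Longrightarrow> finite B \<Longrightarrow> frobenius_independent B \<Longrightarrow>
    (\<And>b. b \<in> B \<Longrightarrow> g b \<in> G M) \<Longrightarrow> (\<Sum>b\<in>B. c b * g b ^ CHAR('k)) \<in> A \<Longrightarrow> b \<in> B \<Longrightarrow> g b \<in> A"
  unfolding root_closed_def by blast

text \<open>Derivatives reduce the claim to constants, where it is the definition of independence.\<close>

lemma frobenius_sum_eq_0:
  assumes p: "prime CHAR('k)" and B: "finite B" "frobenius_independent B"
    and g: "\<forall>b\<in>B. g b \<in> G M" and s: "(\<Sum>b\<in>B. c b * g b ^ CHAR('k)) = 0"
  shows "\<forall>b\<in>B. g b = 0"
  using g s
proof (induction M arbitrary: g rule: less_induct)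
  case (less M)
  let ?p = "CHAR('k)"
  have p0: "?p > 0" using p prime_gt_0_nat by blast
  show ?case
  proof (cases "M = 0")
    case True
    hence "\<forall>b\<in>B. \<exists>a. g b = c a" using less.prems G0_E by blast
    then obtain \<gamma> where \<gamma>: "\<forall>b\<in>B. g b = c (\<gamma> b)" by metis
    hence "c (\<Sum>b\<in>B. b * \<gamma> b ^ ?p) = 0"
      using less.prems(2) by (simp add: c_sum c_mult c_power)
    hence "\<forall>b\<in>B. \<gamma> b = 0" using B by (simp add: c_eq_0 frobenius_independent_def)
    thus ?thesis using \<gamma> by (simp add: c.hom_zero)
  next
    case False
    have "coeff (T j (g b)) r = 0" if "b \<in> B" "r > 0" for b j r
    proof (cases "r \<le> M")
      case True
      have "(\<Sum>b\<in>B. c b * coeff (T j (g b)) r ^ ?p) = 0"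
        using T_frobenius_sum[OF p, of j g B "?p * r"] less.prems(2) p0 by simp
      moreover have "\<forall>b\<in>B. coeff (T j (g b)) r \<in> G (M - r)" using less.prems True T_degree by blast
      ultimately show ?thesis using less.IH[of "M - r" "\<lambda>b. coeff (T j (g b)) r"] that False by auto
    next
      case False
      thus ?thesis using T_degree_high less.prems that by force
    qed
    thus ?thesis using T_detects less.prems False by blast
  qed
qed

end


section \<open>Adjoining one homogeneous element\<close>

text \<open>The invariant of the construction: what must be known about \<open>A\<close> in order to adjoin a
  homogeneous element of degree \<open>d\<close> and obtain a subalgebra of the same kind.\<close>

locale admissible_subalgebra = hasse_algebra c G T
  for c :: "'k::field \<Rightarrow> 'r::comm_ring_1" and G :: "nat \<Rightarrow> 'r set" and T :: "'j \<Rightarrow> 'r \<Rightarrow> 'r poly" +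
  fixes d :: nat and A :: "'r set"
  assumes const_A: "c a \<in> A"
    and add_A: "x \<in> A \<Longrightarrow> y \<in> A \<Longrightarrow> x + y \<in> A"
    and mult_A: "x \<in> A \<Longrightarrow> y \<in> A \<Longrightarrow> x * y \<in> A"
    and component_A: "x \<in> A \<Longrightarrow> component n x \<in> A"
    and taylor_A: "x \<in> A \<Longrightarrow> coeff (T j x) r \<in> A"
    and low_A: "m < d \<Longrightarrow> G m \<subseteq> A"
    and roots_A: "root_closed A"
begin

lemma zero_A: "0 \<in> A" using const_A[of 0] by (simp add: c.hom_zero)
lemma one_A: "1 \<in> A" using const_A[of 1] by (simp add: c_one)

lemma uminus_A: "x \<in> A \<Longrightarrow> - x \<in> A"
  using mult_A[OF const_A[of "- 1"], of x] by (simp add: c_uminus c_one)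

lemma diff_A: "x \<in> A \<Longrightarrow> y \<in> A \<Longrightarrow> x - y \<in> A"
  using add_A[of x "- y"] uminus_A[of y] by simp

lemma sum_A: "(\<And>i. i \<in> I \<Longrightarrow> f i \<in> A) \<Longrightarrow> sum f I \<in> A"
  by (induction I rule: infinite_finite_induct) (auto simp: zero_A add_A)

lemma power_A: "x \<in> A \<Longrightarrow> x ^ n \<in> A"
  by (induction n) (auto simp: one_A mult_A)

sublocale all: int_graded_family "\<lambda>_. A"
  by unfold_locales (auto simp: zero_A add_A mult_A)

sublocale hom: int_graded_family "\<lambda>n. A \<inter> Gz n"
  by unfold_locales (auto simp: zero_A add_A mult_A full.zero_H full.add_H full.mult_H)

end

locale adjoin_element = admissible_subalgebra c G T d A
  for c :: "'k::field \<Rightarrow> 'r::comm_ring_1" and G :: "nat \<Rightarrow> 'r set" and T :: "'j \<Rightarrow> 'r \<Rightarrow> 'r poly"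
    and d A +
  fixes u :: 'r
  assumes d_pos: "d > 0" and u_mem: "u \<in> G d" and u_notin: "u \<notin> A"
begin

lemma Gz_neg: "n < 0 \<Longrightarrow> Gz n = {0}"
  by (simp add: Gz_def)

lemma scalar_multiple_u: "c a * u \<in> A \<Longrightarrow> a = 0"
proof (rule ccontr)
  assume mem: "c a * u \<in> A" and "a \<noteq> 0"
  from \<open>a \<noteq> 0\<close> have "c (inverse a) * (c a * u) = u"
    by (simp only: mult.assoc[symmetric] c_mult[symmetric] left_inverse not_False_eq_True c_one mult_1_left)
  thus False using mult_A[OF const_A mem, of "inverse a"] u_notin by simp
qed

lemma T_u_low: "r > 0 \<Longrightarrow> coeff (T j u) r \<in> A \<inter> Gz (int d - int r)"
proof -
  assume r: "r > 0"
  have "coeff (T j u) r \<in> A"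
  proof (cases "r \<le> d")
    case True
    thus ?thesis using T_degree[OF u_mem True, of j] low_A[of "d - r"] r d_pos by auto
  next
    case False
    thus ?thesis using T_degree_high[OF u_mem, of r j] zero_A by simp
  qed
  thus ?thesis using T_Gz[of u "int d" j r] u_mem by simp
qed

lemma weighted_lifted_hom:
  "hom.weighted d N Q \<Longrightarrow> hom.weighted d (N - int r) (T.lifted j u r Q)"
  by (rule T.weighted_lifted) (auto simp: hom.int_graded_family_axioms taylor_A T_Gz T_0 T_u_low[simplified])

lemma coeff_lifted_mem:
  assumes "\<And>i. coeff Q i \<in> A"
  shows "coeff (T.lifted j u r Q) i \<in> A"
proof -
  have "all.weighted d 0 (T.lifted j u r Q)"
    using T.weighted_lifted[of "\<lambda>_. A" j u d 0 Q r] assms T_u_low all.int_graded_family_axioms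
    by (auto simp: all.weighted_def taylor_A T_0)
  thus ?thesis by (simp add: all.weighted_def)
qed

lemma hom_weighted_neg: "hom.weighted d N Q \<Longrightarrow> N < 0 \<Longrightarrow> Q = 0"
proof (rule poly_eqI)
  fix i assume "hom.weighted d N Q" "N < 0"
  hence "coeff Q i \<in> Gz (N - int (d * i))" "N - int (d * i) < 0"
    by (auto simp: hom.weighted_def simp del: of_nat_mult)
  thus "coeff Q i = coeff 0 i" using Gz_neg by auto
qed

lemma hom_weighted_full: "hom.weighted d N Q \<Longrightarrow> full.weighted d N Q"
  by (auto simp: hom.weighted_def full.weighted_def)

text \<open>The least relation \<open>Q\<close> has the form \<open>c (y - u)\<^sup>e\<close> because the derivatives of the
  coefficients of \<open>Q(u + y)\<close> come from smaller relations. Its next-to-leading coefficient forces \<open>e\<close> to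
  vanish in \<open>k\<close>, and then its constant coefficient puts a smaller power of \<open>u\<close> into \<open>A\<close>.\<close>

lemma weighted_relation_trivial:
  "hom.weighted d (int N) Q \<Longrightarrow> poly Q u = 0 \<Longrightarrow> Q = 0"
proof (induction N arbitrary: Q rule: less_induct)
  case (less N)
  have lifted0: "T.lifted j u r Q = 0" if r: "r > 0" for j r
  proof -
    have w: "hom.weighted d (int N - int r) (T.lifted j u r Q)"
      by (rule weighted_lifted_hom[OF less.prems(1)])
    have e: "poly (T.lifted j u r Q) u = 0"
      using T.coeff_T_poly[of j Q u r] less.prems(2) by simp
    show ?thesis
    proof (cases "r \<le> N")
      case True
      thus ?thesis using less.IH[of "N - r"] w e r by (simp add: of_nat_diff)
    next
      case False
      thus ?thesis using hom_weighted_neg[OF w] by simp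
    qed
  qed
  define b where "b i = coeff (translate u Q) i" for i
  have b_mem: "b i \<in> Gz (int N - int (d * i))" for i
    using full.weighted_translate[of u d "int N" Q] hom_weighted_full[OF less.prems(1)] u_mem
    unfolding b_def full.weighted_def by simp
  have T_b: "coeff (T j (b i)) r = 0" if "r > 0" for j i r
    using T.coeff_T_translate[of j u Q i r] lifted0[OF that] by (simp add: b_def)
  have b_zero: "b i = 0" if ne: "N \<noteq> d * i" for i
  proof (cases "N < d * i")
    case True
    hence "int N - int (d * i) < 0" by linarith
    thus ?thesis using b_mem[of i] Gz_neg by blast
  next
    case False
    hence "int N - int (d * i) = int (N - d * i)" by (simp add: of_nat_diff)
    hence "b i \<in> G (N - d * i)" using b_mem[of i] by (metis Gz_of_nat)
    thus ?thesis using T_detects[of "b i" "N - d * i"] T_b False ne by simp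
  qed
  have b0: "b 0 = 0" using less.prems(2) by (simp add: b_def coeff_translate_0)
  show "Q = 0"
  proof (rule ccontr)
    assume Q: "Q \<noteq> 0"
    hence "translate u Q \<noteq> 0" using translate_uminus[of u Q] by auto
    then obtain e where e: "b e \<noteq> 0" by (auto simp: poly_eq_iff b_def)
    hence N: "N = d * e" using b_zero by blast
    obtain e' where e': "e = Suc e'" using e b0 by (cases e) auto
    have b_ne: "b i = 0" if "i \<noteq> e" for i using b_zero[of i] that N d_pos by auto
    have tr: "translate u Q = monom (b e) e"
      by (rule poly_eqI) (use b_ne in \<open>auto simp: b_def\<close>)
    have deg: "degree Q \<le> e"
      using degree_translate_le[of "- u" "translate u Q", unfolded translate_uminus]
        degree_monom_le[of "b e" e] unfolding tr by simp
    have "b e \<in> G 0" using b_mem[of e] N by (simp add: Gz_def)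
    then obtain \<kappa> where \<kappa>: "b e = c \<kappa>" by (rule G0_E)
    have \<kappa>0: "\<kappa> \<noteq> 0" using e \<kappa> by (auto simp: c.hom_zero)
    have coeff_A: "coeff Q i \<in> A" for i using less.prems(1) by (auto simp: hom.weighted_def)
    have "c (of_nat e * \<kappa>) * u = - coeff Q e'"
    proof -
      have "coeff Q e = c \<kappa>" using coeff_translate_high[OF deg, of u] \<kappa> by (simp add: b_def)
      moreover have "0 = coeff Q e' + of_nat e * coeff Q e * u"
        using coeff_translate_next_to_high[of Q e' u] deg b_ne[of e'] e' by (simp add: b_def)
      ultimately show ?thesis by (simp add: c_mult c_of_nat eq_neg_iff_add_eq_0 add.commute)
    qed
    hence mem: "c (of_nat e * \<kappa>) * u \<in> A" using uminus_A[OF coeff_A[of e']] by simp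
    hence "of_nat e * \<kappa> = 0" by (rule scalar_multiple_u)
    hence p_dvd: "CHAR('k) dvd e" using \<kappa>0 by (simp add: of_nat_eq_0_iff_char_dvd)
    hence p: "prime CHAR('k)"
      using e' by (intro prime_CHAR_semidom) (auto intro: Nat.gr0I)
    from p_dvd obtain m where m: "e = CHAR('k) * m" by blast
    have m0: "m > 0" using m e' by (cases m) auto
    have "coeff Q 0 = c \<kappa> * (- u) ^ e"
      using poly_translate_uminus[of u Q] unfolding tr by (simp add: poly_monom \<kappa>)
    also have "(- u) ^ e = ((- u) ^ m) ^ CHAR('k)"
      unfolding m by (simp add: power_mult[symmetric] mult.commute)
    finally have "coeff Q 0 = c \<kappa> * ((- u) ^ m) ^ CHAR('k)" .
    hence root: "(\<Sum>b\<in>{\<kappa>}. c b * ((- u) ^ m) ^ CHAR('k)) \<in> A" using coeff_A[of 0] by simp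
    have ind: "frobenius_independent {\<kappa>}"
      using \<kappa>0 by (simp add: frobenius_independent_def)
    have "(- u) ^ m \<in> A"
      by (rule root_closedD[OF roots_A p _ ind _ root, of "d * m" \<kappa>])
         (auto intro: power_mem uminus_mem u_mem)
    hence um: "(- u) ^ m \<in> A \<inter> G (d * m)" using power_mem[OF uminus_mem[OF u_mem], of m] by simp
    define R where "R = monom ((- 1) ^ m) m - [:(- u) ^ m:]"
    have "hom.weighted d (int (d * m)) R"
      unfolding hom.weighted_def
    proof
      fix i
      have 1: "(- 1) ^ m \<in> A \<inter> G 0"
        using power_A[OF uminus_A[OF one_A], of m] power_mem[OF uminus_mem[OF one_mem], of m] by simp
      consider "i = 0" | "i = m" | "i \<noteq> 0" "i \<noteq> m" by blast
      thus "coeff R i \<in> A \<inter> Gz (int (d * m) - int (d * i))"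
      proof cases
        case 1
        hence "coeff R i = - ((- u) ^ m)" using m0 by (simp add: R_def)
        thus ?thesis using 1 um uminus_A uminus_mem by (simp del: of_nat_mult)
      next
        case 2
        hence "coeff R i = (- 1) ^ m" using m0 by (simp add: R_def coeff_pCons split: nat.split)
        thus ?thesis using 2 1 by (simp add: Gz_def)
      next
        case 3
        hence "coeff R i = 0" by (simp add: R_def coeff_pCons split: nat.split)
        thus ?thesis by (simp add: zero_A full.zero_H)
      qed
    qed
    moreover have "poly R u = 0"
      by (simp add: R_def poly_monom power_mult_distrib[symmetric])
    moreover have "d * m < N"
      using m0 d_pos prime_gt_1_nat[OF p] by (simp add: N m)
    ultimately have "R = 0" using less.IH by blast
    hence "coeff R m = 0" by simp
    moreover have "coeff R m = (- 1) ^ m" using m0 by (simp add: R_def coeff_pCons split: nat.split)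
    moreover have "(- 1) ^ m * (- 1) ^ m = (1 :: 'r)" by (simp flip: power_mult_distrib)
    ultimately show False by simp
  qed
qed

text \<open>The part of \<open>Q\<close> whose value at \<open>u\<close> is homogeneous of degree \<open>N\<close>; every relation splits
  into such parts.\<close>

definition weight_part :: "nat \<Rightarrow> 'r poly \<Rightarrow> 'r poly" where
  "weight_part N Q = (\<Sum>i\<le>degree Q. monom (if d * i \<le> N then component (N - d * i) (coeff Q i) else 0) i)"

lemma coeff_weight_part:
  "coeff (weight_part N Q) i = (if d * i \<le> N then component (N - d * i) (coeff Q i) else 0)"
proof -
  have "coeff (weight_part N Q) i =
      (\<Sum>k\<le>degree Q. if k = i then (if d * i \<le> N then component (N - d * i) (coeff Q i) else 0) else 0)"
    by (auto simp: weight_part_def coeff_sum intro!: sum.cong)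
  also have "\<dots> = (if d * i \<le> N then component (N - d * i) (coeff Q i) else 0)"
    by (auto simp: coeff_eq_0)
  finally show ?thesis .
qed

lemma component_poly: "component N (poly Q u) = poly (weight_part N Q) u"
proof -
  have "component N (poly Q u) = (\<Sum>i\<le>degree Q. component N (coeff Q i * u ^ i))"
    by (simp add: poly_altdef component_sum)
  also have "\<dots> = (\<Sum>i\<le>degree Q. (if d * i \<le> N then component (N - d * i) (coeff Q i) else 0) * u ^ i)"
    by (intro sum.cong refl) (simp add: component_mult_hom[OF power_mem[OF u_mem]])
  also have "\<dots> = poly (weight_part N Q) u"
    by (simp add: weight_part_def poly_sum poly_monom)
  finally show ?thesis .
qed

lemma weighted_weight_part:
  assumes "\<And>i. coeff Q i \<in> A"
  shows "hom.weighted d (int N) (weight_part N Q)"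
  unfolding hom.weighted_def coeff_weight_part
  using assms by (auto simp: component_A component_props(1) Gz_def zero_A zero_mem nat_diff_distrib nat_mult_distrib)
     (simp_all flip: of_nat_mult add: nat_diff_distrib component_props)

lemma transcendental:
  assumes Q: "\<And>i. coeff Q i \<in> A" and "poly Q u = 0"
  shows "Q = 0"
proof (rule poly_eqI)
  fix i
  have "component n (coeff Q i) = 0" for n
  proof -
    have "weight_part (n + d * i) Q = 0"
      using weighted_relation_trivial[OF weighted_weight_part[OF Q]] component_poly[of "n + d * i" Q] assms(2)
      by simp
    hence "coeff (weight_part (n + d * i) Q) i = 0" by simp
    thus ?thesis by (simp add: coeff_weight_part)
  qed
  thus "coeff Q i = coeff 0 i" using component_all_zero by simp
qed

definition adjoin :: "'r set" where
  "adjoin = {poly Q u | Q. \<forall>i. coeff Q i \<in> A}"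

lemma adjoinI: "(\<And>i. coeff Q i \<in> A) \<Longrightarrow> poly Q u \<in> adjoin"
  by (auto simp: adjoin_def)

lemma adjoinE:
  assumes "x \<in> adjoin" obtains Q where "x = poly Q u" "\<And>i. coeff Q i \<in> A"
  using assms by (auto simp: adjoin_def)

lemma adjoin_homE:
  assumes "x \<in> adjoin" "x \<in> G N"
  obtains Q where "x = poly Q u" "hom.weighted d (int N) Q"
proof -
  from assms(1) obtain Q where Q: "x = poly Q u" "\<And>i. coeff Q i \<in> A" by (rule adjoinE) blast
  have "x = component N x" using component_hom[OF assms(2)] by simp
  thus ?thesis using that[OF _ weighted_weight_part[OF Q(2)]] component_poly[of N Q] Q(1) by simp
qed

lemma A_sub_adjoin: "A \<subseteq> adjoin"
proof
  fix x assume "x \<in> A"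
  thus "x \<in> adjoin" using adjoinI[of "[:x:]"] zero_A by (auto simp: coeff_pCons split: nat.splits)
qed

lemma u_adjoin: "u \<in> adjoin"
  using adjoinI[of "[:0, 1:]"] zero_A one_A by (auto simp: coeff_pCons split: nat.splits)

lemma adjoin_add: "x \<in> adjoin \<Longrightarrow> y \<in> adjoin \<Longrightarrow> x + y \<in> adjoin"
proof -
  assume "x \<in> adjoin" "y \<in> adjoin"
  then obtain P Q where "x = poly P u" "\<And>i. coeff P i \<in> A" "y = poly Q u" "\<And>i. coeff Q i \<in> A"
    by (auto simp: adjoin_def)
  thus ?thesis using adjoinI[of "P + Q"] by (simp add: add_A)
qed

lemma adjoin_mult:
  assumes "x \<in> adjoin" "y \<in> adjoin" shows "x * y \<in> adjoin"
proof -
  from assms obtain P Q where PQ: "x = poly P u" "\<And>i. coeff P i \<in> A" "y = poly Q u" "\<And>i. coeff Q i \<in> A"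
    by (auto simp: adjoin_def)
  have "poly (P * Q) u \<in> adjoin" by (rule adjoinI) (auto simp: coeff_mult PQ intro!: sum_A mult_A)
  thus ?thesis by (simp add: PQ)
qed

lemma adjoin_sum: "(\<And>i. i \<in> I \<Longrightarrow> f i \<in> adjoin) \<Longrightarrow> sum f I \<in> adjoin"
  using A_sub_adjoin zero_A by (induction I rule: infinite_finite_induct) (auto simp: adjoin_add)

lemma adjoin_power: "x \<in> adjoin \<Longrightarrow> x ^ n \<in> adjoin"
  using A_sub_adjoin one_A by (induction n) (auto simp: adjoin_mult)

lemma adjoin_uminus: "x \<in> adjoin \<Longrightarrow> - x \<in> adjoin"
  using adjoin_mult[of "- 1" x] A_sub_adjoin uminus_A[OF one_A] by auto

lemma adjoin_taylor: "x \<in> adjoin \<Longrightarrow> coeff (T j x) r \<in> adjoin"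
proof -
  assume "x \<in> adjoin"
  then obtain Q where "x = poly Q u" "\<And>i. coeff Q i \<in> A" by (rule adjoinE) blast
  thus ?thesis using T.coeff_T_poly[of j Q u r] adjoinI[OF coeff_lifted_mem] by simp
qed

lemma adjoin_component: "x \<in> adjoin \<Longrightarrow> component n x \<in> adjoin"
proof -
  assume "x \<in> adjoin"
  then obtain Q where "x = poly Q u" "\<And>i. coeff Q i \<in> A" by (rule adjoinE) blast
  thus ?thesis using weighted_weight_part[of Q n] adjoinI[of "weight_part n Q"]
    by (simp add: component_poly hom.weighted_def)
qed

text \<open>Let \<open>a = \<Sum>b\<in>B. b g\<^sub>b\<^sup>p\<close> lie in \<open>A[u]\<close>, say \<open>a = Q(u)\<close> with \<open>Q\<close> homogeneous, and
  proceed by induction on the degree \<open>M\<close> of the \<open>g\<^sub>b\<close>. The derivatives of \<open>a\<close> are combinations of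
  the same shape in smaller degree, so by induction the derivatives of the \<open>g\<^sub>b\<close> lie in \<open>A[u]\<close>, and as
  \<open>u\<close> is transcendental these identities hold between polynomials over \<open>A\<close>. Consequently, in the
  expansion \<open>Q(u + y) = \<Sum>i. b\<^sub>i y\<^sup>i\<close> every \<open>b\<^sub>i\<close> with \<open>i > 0\<close> of positive degree vanishes if \<open>p\<close>
  does not divide \<open>i\<close>, and otherwise is again a combination of \<open>p\<close>-th powers, of elements that lie
  in \<open>A[u]\<close> by induction. Setting \<open>y = - u\<close> shows that the constant coefficient of \<open>Q\<close>, an element
  of \<open>A\<close>, is a combination of \<open>p\<close>-th powers of elements differing from the \<open>g\<^sub>b\<close> by elements
  of \<open>A[u]\<close>, so the hypothesis on \<open>A\<close> applies.\<close>

lemma adjoin_roots: "root_closed adjoin"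
proof -
  let ?p = "CHAR('k)"
  have "\<forall>b\<in>B. g b \<in> adjoin"
    if p: "prime ?p" and B: "finite B" "frobenius_independent B"
      and "\<forall>b\<in>B. g b \<in> G M" "(\<Sum>b\<in>B. c b * g b ^ ?p) \<in> adjoin" for B M g
    using that(4,5)
  proof (induction M arbitrary: g rule: less_induct)
    case (less M)
    have p2: "?p > 1" using p prime_gt_1_nat by blast
    hence p0: "?p > 0" by simp
    define a where "a = (\<Sum>b\<in>B. c b * g b ^ ?p)"
    show ?case
    proof (cases "M < d")
      case True
      thus ?thesis using low_A[OF True] A_sub_adjoin less.prems(1) by blast
    next
      case False
      hence dM: "d \<le> M" by simp
      have "c b * g b ^ ?p \<in> G (?p * M)" if "b \<in> B" for b
        using mult_mem[OF c_mem power_mem[of "g b" M ?p], of b] less.prems(1) that by (simp add: mult.commute)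
      hence a_G: "a \<in> G (?p * M)" unfolding a_def by (rule sum_mem)
      have a_adj: "a \<in> adjoin" using less.prems(2) by (simp add: a_def)
      obtain Q where Q: "a = poly Q u" "hom.weighted d (int (?p * M)) Q"
        by (rule adjoin_homE[OF a_adj a_G])
      have coeff_A: "coeff Q i \<in> A" for i using Q(2) by (auto simp: hom.weighted_def)
      have T_g: "coeff (T j (g b)) r \<in> adjoin" if "b \<in> B" "r > 0" for j b r
      proof (cases "r \<le> M")
        case True
        have "(\<Sum>b\<in>B. c b * coeff (T j (g b)) r ^ ?p) = coeff (T j a) (?p * r)"
          unfolding a_def using T_frobenius_sum[OF p, of j g B "?p * r"] p0 by simp
        hence "(\<Sum>b\<in>B. c b * coeff (T j (g b)) r ^ ?p) \<in> adjoin"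
          using adjoin_taylor[OF a_adj] by simp
        moreover have "\<forall>b\<in>B. coeff (T j (g b)) r \<in> G (M - r)"
          using less.prems(1) True T_degree by blast
        ultimately show ?thesis
          using less.IH[of "M - r" "\<lambda>b. coeff (T j (g b)) r"] that True by auto
      next
        case False
        thus ?thesis using T_degree_high less.prems(1) that A_sub_adjoin zero_A by (metis not_le subsetD)
      qed
      have lifted0: "T.lifted j u r Q = 0" if "\<not> ?p dvd r" for j r
      proof (rule transcendental)
        show "poly (T.lifted j u r Q) u = 0"
          using T.coeff_T_poly[of j Q u r] T_frobenius_sum[OF p, of j g B r] that by (simp add: Q(1)[symmetric] a_def)
      qed (rule coeff_lifted_mem[OF coeff_A])
      have lifted1: "\<exists>P. T.lifted j u (?p * r) Q = (\<Sum>b\<in>B. smult (c b) (P b ^ ?p))" if r: "r > 0" for j r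
      proof -
        have "\<forall>b\<in>B. \<exists>P. coeff (T j (g b)) r = poly P u \<and> (\<forall>i. coeff P i \<in> A)"
          using T_g[OF _ r] by (metis adjoinE)
        then obtain P where P: "\<And>b. b \<in> B \<Longrightarrow> coeff (T j (g b)) r = poly (P b) u"
          "\<And>b i. b \<in> B \<Longrightarrow> coeff (P b) i \<in> A" by metis
        have "T.lifted j u (?p * r) Q - (\<Sum>b\<in>B. smult (c b) (P b ^ ?p)) = 0"
        proof (rule transcendental)
          have "poly (T.lifted j u (?p * r) Q) u = (\<Sum>b\<in>B. c b * coeff (T j (g b)) r ^ ?p)"
            using T.coeff_T_poly[of j Q u "?p * r"] T_frobenius_sum[OF p, of j g B "?p * r"] p0
            by (simp add: Q(1)[symmetric] a_def)
          also have "\<dots> = poly (\<Sum>b\<in>B. smult (c b) (P b ^ ?p)) u"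
            by (simp add: poly_sum P(1))
          finally show "poly (T.lifted j u (?p * r) Q - (\<Sum>b\<in>B. smult (c b) (P b ^ ?p))) u = 0" by simp
          show "coeff (T.lifted j u (?p * r) Q - (\<Sum>b\<in>B. smult (c b) (P b ^ ?p))) i \<in> A" for i
            using P(2) zero_A
            by (auto simp: coeff_sum coeff_frobenius[OF p]
                intro!: diff_A sum_A mult_A const_A power_A coeff_lifted_mem coeff_A)
        qed
        thus ?thesis by auto
      qed
      define b where "b i = coeff (translate u Q) i" for i
      have b_mem: "b i \<in> Gz (int (?p * M) - int (d * i))" for i
        using full.weighted_translate[of u d "int (?p * M)" Q] hom_weighted_full[OF Q(2)] u_mem
        unfolding b_def full.weighted_def by simp
      interpret adj: int_graded_family "\<lambda>_. adjoin"
        using A_sub_adjoin zero_A by unfold_locales (auto simp: adjoin_add adjoin_mult)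
      have b_adj: "b i \<in> adjoin" for i
        using adj.weighted_translate[of u d 0 Q] u_adjoin coeff_A A_sub_adjoin
        unfolding b_def adj.weighted_def by blast
      \<comment> \<open>The derivatives of the \<open>b\<^sub>i\<close> are read off from the lifted relations.\<close>
      have T_b: "coeff (T j (b i)) r = coeff (translate u (T.lifted j u r Q)) i" for j i r
        using T.coeff_T_translate[of j u Q i r] by (simp add: b_def)
      have T_b0: "coeff (T j (b i)) r = 0" if "\<not> ?p dvd r" for j i r
        by (simp add: T_b lifted0[OF that])
      have T_b1: "\<exists>h. coeff (T j (b i)) (?p * r) = (if ?p dvd i then \<Sum>b\<in>B. c b * h b ^ ?p else 0)"
        if r: "r > 0" for j i r
      proof -
        obtain P where P: "T.lifted j u (?p * r) Q = (\<Sum>b\<in>B. smult (c b) (P b ^ ?p))"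
          using lifted1[OF r] by blast
        show ?thesis
          by (rule exI[of _ "\<lambda>b. coeff (translate u (P b)) (i div ?p)"])
             (simp add: T_b P translate_sum translate_smult translate_power coeff_sum coeff_frobenius[OF p])
      qed
      have b_high: "b i = 0" if "?p * M < d * i" for i
      proof -
        have "int (?p * M) - int (d * i) < 0" using that by linarith
        thus ?thesis using b_mem[of i] Gz_neg by blast
      qed
      have b_G: "b i \<in> G (?p * M - d * i)" if "d * i \<le> ?p * M" for i
        using b_mem[of i] that by (metis Gz_of_nat of_nat_diff)
      have b_low: "b i = 0" if "d * i < ?p * M" "\<not> ?p dvd i" for i
      proof (rule T_detects[OF b_G])
        show "coeff (T j (b i)) r = 0" if "r > 0" for j r
        proof (cases "?p dvd r")
          case True
          then obtain s where "r = ?p * s" by blast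
          thus ?thesis using T_b1[of s j i] \<open>r > 0\<close> \<open>\<not> ?p dvd i\<close> by auto
        qed (rule T_b0)
      qed (use that in auto)
      have b_root: "\<exists>h. (\<forall>b\<in>B. h b \<in> G (M - d * m)) \<and> b (?p * m) = (\<Sum>b\<in>B. c b * h b ^ ?p)"
        if "d * m < M" for m
      proof (rule T_roots[OF p B(1)])
        have "d * (?p * m) \<le> ?p * M" using that by simp
        from b_G[OF this] show "b (?p * m) \<in> G (?p * (M - d * m))"
          by (simp add: diff_mult_distrib2 mult.left_commute)
        show "\<exists>h. coeff (T j (b (?p * m))) (?p * r) = (\<Sum>b\<in>B. c b * h b ^ ?p)" if "r > 0" for j r
          using T_b1[OF that, of j "?p * m"] by simp
      qed (use that T_b0 in auto)
      \<comment> \<open>The coefficient of degree zero has no derivatives to inspect. If \<open>p\<close> does not divide its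
        index, the two highest coefficients of \<open>Q\<close> would express \<open>u\<close> in terms of \<open>A\<close>.\<close>
      have b_top: "b e = 0" if e: "d * e = ?p * M" "\<not> ?p dvd e" for e
      proof -
        obtain e' where e': "e = Suc e'" using e(2) by (cases e) auto
        have "d * e' < d * e" using e' d_pos by simp
        hence lt: "d * e' < ?p * M" by (simp only: e(1))
        have "b e' \<in> A"
        proof (cases "?p dvd e'")
          case True
          then obtain m where m: "e' = ?p * m" by blast
          have dm: "d * m < M" using lt p0 by (simp add: m mult.left_commute)
          have "?p * (M - d * m) = d"
            using e by (simp add: e' m diff_mult_distrib2 mult.left_commute algebra_simps)
          moreover have "1 * (M - d * m) < ?p * (M - d * m)"
            using dm p2 by (intro mult_strict_right_mono) auto
          ultimately have "M - d * m < d" by simp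
          moreover obtain h where h: "\<forall>b\<in>B. h b \<in> G (M - d * m)" "b e' = (\<Sum>b\<in>B. c b * h b ^ ?p)"
            using b_root[OF dm] m by blast
          ultimately have "h b \<in> A" if "b \<in> B" for b using low_A that by blast
          thus ?thesis unfolding h(2) by (intro sum_A mult_A const_A power_A)
        next
          case False
          thus ?thesis using b_low[OF lt] zero_A by simp
        qed
        have deg: "degree Q \<le> e"
        proof (rule degree_le, intro allI impI)
          fix i assume "e < i"
          hence "int (?p * M) - int (d * i) < 0" using e(1) d_pos by (metis diff_less_0_iff_less mult_less_mono2 of_nat_less_iff)
          thus "coeff Q i = 0" using Q(2) Gz_neg unfolding hom.weighted_def by blast
        qed
        have "b e \<in> G 0" using b_G[of e] e by simp
        then obtain \<kappa> where \<kappa>: "b e = c \<kappa>" by (rule G0_E)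
        have "coeff Q e = c \<kappa>" using coeff_translate_high[OF deg, of u] \<kappa> by (simp add: b_def)
        hence "b e' = coeff Q e' + of_nat e * c \<kappa> * u"
          using coeff_translate_next_to_high[of Q e' u] deg e' by (simp add: b_def)
        hence "c (of_nat e * \<kappa>) * u = b e' - coeff Q e'" by (simp add: c_mult c_of_nat)
        hence "c (of_nat e * \<kappa>) * u \<in> A" using diff_A[OF \<open>b e' \<in> A\<close> coeff_A[of e']] by simp
        hence "of_nat e * \<kappa> = 0" by (rule scalar_multiple_u)
        hence "\<kappa> = 0" using e(2) by (simp add: of_nat_eq_0_iff_char_dvd)
        thus ?thesis using \<kappa> by (simp add: c.hom_zero)
      qed
      \<comment> \<open>The remaining coefficient of degree zero is a scalar \<open>\<kappa>\<close> that need not lie in the span of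
        \<open>B\<close>, so \<open>B\<close> is enlarged by at most one element.\<close>
      have "\<exists>\<kappa>. \<forall>i. d * i = ?p * M \<longrightarrow> b i = c \<kappa>"
      proof (cases "\<exists>e. d * e = ?p * M")
        case True
        then obtain e where e: "d * e = ?p * M" by blast
        hence "b e \<in> G 0" using b_G[of e] by simp
        then obtain \<kappa> where "b e = c \<kappa>" by (rule G0_E)
        thus ?thesis using e d_pos by (metis mult_cancel1 less_irrefl)
      qed auto
      then obtain \<kappa> where \<kappa>: "\<And>i. d * i = ?p * M \<Longrightarrow> b i = c \<kappa>" by blast
      obtain B' \<gamma> where B': "finite B'" "frobenius_independent B'" "B \<subseteq> B'"
        and \<gamma>: "\<kappa> = (\<Sum>b\<in>B'. b * \<gamma> b ^ ?p)"
        using frobenius_independent_extend[OF p B, of \<kappa>] by blast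
      have "\<exists>K. (\<forall>\<beta>\<in>B'. K \<beta> \<in> adjoin \<inter> G M) \<and> b i * (- u) ^ i = (\<Sum>\<beta>\<in>B'. c \<beta> * K \<beta> ^ ?p)"
        if i: "i > 0" for i
      proof (cases "b i = 0")
        case True
        thus ?thesis using A_sub_adjoin zero_A zero_mem p0 by (intro exI[of _ "\<lambda>_. 0"]) (auto simp: power_0_left)
      next
        case False
        have p_dvd: "?p dvd i" using False b_low b_top b_high by (metis linorder_neqE_nat)
        then obtain m where m: "i = ?p * m" by blast
        have m0: "m > 0" using m i by (cases m) auto
        have "d * i \<le> ?p * M" using b_high False by (metis not_le)
        hence "d * m \<le> M" using p0 by (simp add: m mult.left_commute)
        then consider "d * m = M" | "d * m < M" by linarith
        thus ?thesis
        proof cases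
          case 1
          hence "d * i = ?p * M" by (simp add: m mult.left_commute)
          hence "b i = (\<Sum>\<beta>\<in>B'. c \<beta> * c (\<gamma> \<beta>) ^ ?p)"
            by (simp only: \<kappa> \<gamma> c_sum c_mult c_power)
          moreover have "(- u) ^ i = ((- u) ^ m) ^ ?p"
            by (simp add: m power_mult[symmetric] mult.commute)
          ultimately have "b i * (- u) ^ i = (\<Sum>\<beta>\<in>B'. c \<beta> * (c (\<gamma> \<beta>) * (- u) ^ m) ^ ?p)"
            by (simp add: sum_distrib_right power_mult_distrib mult.assoc)
          moreover have "c (\<gamma> \<beta>) * (- u) ^ m \<in> adjoin \<inter> G M" for \<beta>
            using mult_mem[OF c_mem power_mem[OF uminus_mem[OF u_mem]], of "\<gamma> \<beta>" m] 1 const_A A_sub_adjoin u_adjoin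
            by (auto intro!: adjoin_mult adjoin_power adjoin_uminus)
          ultimately show ?thesis by (intro exI[of _ "\<lambda>\<beta>. c (\<gamma> \<beta>) * (- u) ^ m"]) simp
        next
          case 2
          then obtain h where h: "\<forall>b\<in>B. h b \<in> G (M - d * m)" "b i = (\<Sum>b\<in>B. c b * h b ^ ?p)"
            using b_root[of m] m by blast
          have h_adj: "\<forall>b\<in>B. h b \<in> adjoin"
            using less.IH[of "M - d * m" h] h b_adj[of i] m0 d_pos 2 by auto
          define K where "K \<beta> = (if \<beta> \<in> B then h \<beta> * (- u) ^ m else 0)" for \<beta>
          have "(- u) ^ i = ((- u) ^ m) ^ ?p"
            by (simp add: m power_mult[symmetric] mult.commute)
          hence "b i * (- u) ^ i = (\<Sum>\<beta>\<in>B. c \<beta> * K \<beta> ^ ?p)"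
            by (simp add: h(2) K_def sum_distrib_right power_mult_distrib mult.assoc)
          also have "\<dots> = (\<Sum>\<beta>\<in>B'. c \<beta> * K \<beta> ^ ?p)"
            by (rule sum.mono_neutral_left) (use B' p0 in \<open>auto simp: K_def power_0_left\<close>)
          finally have "b i * (- u) ^ i = (\<Sum>\<beta>\<in>B'. c \<beta> * K \<beta> ^ ?p)" .
          moreover have "K \<beta> \<in> adjoin \<inter> G M" for \<beta>
          proof (cases "\<beta> \<in> B")
            case True
            thus ?thesis
              using mult_mem[of "h \<beta>" "M - d * m", OF _ power_mem[OF uminus_mem[OF u_mem], of m]] h(1) 2 h_adj u_adjoin
              by (auto simp: K_def intro!: adjoin_mult adjoin_power adjoin_uminus)
          next
            case False
            thus ?thesis using A_sub_adjoin zero_A zero_mem by (auto simp: K_def)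
          qed
          ultimately show ?thesis by (intro exI[of _ K]) simp
        qed
      qed
      then obtain K where K: "\<And>i \<beta>. i > 0 \<Longrightarrow> \<beta> \<in> B' \<Longrightarrow> K i \<beta> \<in> adjoin \<inter> G M"
        "\<And>i. i > 0 \<Longrightarrow> b i * (- u) ^ i = (\<Sum>\<beta>\<in>B'. c \<beta> * K i \<beta> ^ ?p)" by metis
      \<comment> \<open>Evaluate \<open>Q(u + y)\<close> at \<open>y = - u\<close> and collect the \<open>p\<close>-th powers with the same scalar.\<close>
      define D where "D = degree (translate u Q)"
      define f where "f \<beta> = (if \<beta> \<in> B then g \<beta> else 0) + (\<Sum>i=1..D. K i \<beta>)" for \<beta>
      have f_G: "f \<beta> \<in> G M" if "\<beta> \<in> B'" for \<beta>
        unfolding f_def using K(1) that less.prems(1) by (auto intro!: add_mem sum_mem zero_mem)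
      have "coeff Q 0 = (\<Sum>i\<le>D. b i * (- u) ^ i)"
        using poly_translate_uminus[of u Q] by (simp add: poly_altdef b_def D_def)
      also have "\<dots> = b 0 + (\<Sum>i=1..D. b i * (- u) ^ i)"
        by (simp add: sum.atMost_shift sum.shift_bounds_Suc_ivl atLeast0LessThan[symmetric] sum.atLeast1_atMost_eq)
      also have "b 0 = a" by (simp add: b_def coeff_translate_0 Q(1))
      also have "(\<Sum>i=1..D. b i * (- u) ^ i) = (\<Sum>i=1..D. \<Sum>\<beta>\<in>B'. c \<beta> * K i \<beta> ^ ?p)"
        by (intro sum.cong refl K(2)) simp
      also have "\<dots> = (\<Sum>\<beta>\<in>B'. \<Sum>i=1..D. c \<beta> * K i \<beta> ^ ?p)"
        by (rule sum.swap)
      also have "a = (\<Sum>\<beta>\<in>B'. c \<beta> * (if \<beta> \<in> B then g \<beta> else 0) ^ ?p)"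
        unfolding a_def by (rule sum.mono_neutral_cong_left) (use B' p0 in \<open>auto simp: power_0_left\<close>)
      also have "(\<Sum>\<beta>\<in>B'. c \<beta> * (if \<beta> \<in> B then g \<beta> else 0) ^ ?p) + (\<Sum>\<beta>\<in>B'. \<Sum>i=1..D. c \<beta> * K i \<beta> ^ ?p)
          = (\<Sum>\<beta>\<in>B'. c \<beta> * f \<beta> ^ ?p)"
        by (simp add: f_def frobenius_add[OF p] frobenius_sum[OF p] distrib_left sum.distrib sum_distrib_left)
      finally have "(\<Sum>\<beta>\<in>B'. c \<beta> * f \<beta> ^ ?p) \<in> A" using coeff_A[of 0] by simp
      hence f_A: "f \<beta> \<in> A" if "\<beta> \<in> B'" for \<beta>
        using root_closedD[OF roots_A p B'(1,2), of f M \<beta>] f_G that by blast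
      show ?thesis
      proof
        fix \<beta> assume \<beta>: "\<beta> \<in> B"
        hence "g \<beta> = f \<beta> + - (\<Sum>i=1..D. K i \<beta>)" by (simp add: f_def)
        moreover have "f \<beta> \<in> adjoin" using f_A A_sub_adjoin B'(3) \<beta> by blast
        moreover have "(\<Sum>i=1..D. K i \<beta>) \<in> adjoin" using K(1) B'(3) \<beta> by (intro adjoin_sum) auto
        ultimately show "g \<beta> \<in> adjoin" by (metis adjoin_add adjoin_uminus)
      qed
    qed
  qed
  thus ?thesis unfolding root_closed_def by blast
qed

lemma admissible_adjoin: "admissible_subalgebra c G T d adjoin"
proof
  show "c a \<in> adjoin" for a using A_sub_adjoin const_A by blast
  show "G m \<subseteq> adjoin" if "m < d" for m using low_A[OF that] A_sub_adjoin by blast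
qed (auto intro: adjoin_add adjoin_mult adjoin_component adjoin_taylor adjoin_roots)

end


section \<open>Generated subalgebras\<close>

lemma generated_algebra_mono: "X \<subseteq> Y \<Longrightarrow> generated_algebra c X \<subseteq> generated_algebra c Y"
proof
  fix x assume "x \<in> generated_algebra c X" "X \<subseteq> Y"
  thus "x \<in> generated_algebra c Y" by induction (auto intro: generated_algebra.intros)
qed

lemma generated_algebra_minimal:
  "X \<subseteq> generated_algebra c Y \<Longrightarrow> generated_algebra c X \<subseteq> generated_algebra c Y"
proof
  fix x assume "x \<in> generated_algebra c X" "X \<subseteq> generated_algebra c Y"
  thus "x \<in> generated_algebra c Y" by induction (auto intro: generated_algebra.intros)
qed

lemma generated_algebra_finitary:
  "x \<in> generated_algebra c (X \<union> Y) \<Longrightarrow> \<exists>F. finite F \<and> F \<subseteq> Y \<and> x \<in> generated_algebra c (X \<union> F)"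
proof (induction rule: generated_algebra.induct)
  case (const a)
  show ?case by (intro exI[of _ "{}"]) (auto intro: generated_algebra.intros)
next
  case (incl s)
  show ?case
  proof (cases "s \<in> X")
    case True
    thus ?thesis by (intro exI[of _ "{}"]) (auto intro: generated_algebra.intros)
  next
    case False
    thus ?thesis using incl by (intro exI[of _ "{s}"]) (auto intro: generated_algebra.intros)
  qed
next
  case (add x y)
  then obtain F F' where F: "finite F" "F \<subseteq> Y" "x \<in> generated_algebra c (X \<union> F)"
    and F': "finite F'" "F' \<subseteq> Y" "y \<in> generated_algebra c (X \<union> F')" by blast
  have "x + y \<in> generated_algebra c (X \<union> (F \<union> F'))"
    using F(3) F'(3) generated_algebra_mono[of "X \<union> F" "X \<union> (F \<union> F')" c]
      generated_algebra_mono[of "X \<union> F'" "X \<union> (F \<union> F')" c]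
    by (intro generated_algebra.add) auto
  thus ?case using F F' by (intro exI[of _ "F \<union> F'"]) auto
next
  case (mult x y)
  then obtain F F' where F: "finite F" "F \<subseteq> Y" "x \<in> generated_algebra c (X \<union> F)"
    and F': "finite F'" "F' \<subseteq> Y" "y \<in> generated_algebra c (X \<union> F')" by blast
  have "x * y \<in> generated_algebra c (X \<union> (F \<union> F'))"
    using F(3) F'(3) generated_algebra_mono[of "X \<union> F" "X \<union> (F \<union> F')" c]
      generated_algebra_mono[of "X \<union> F'" "X \<union> (F \<union> F')" c]
    by (intro generated_algebra.mult) auto
  thus ?case using F F' by (intro exI[of _ "F \<union> F'"]) auto
qed

lemma generated_algebra_insert_redundant:
  "u \<in> generated_algebra c X \<Longrightarrow> generated_algebra c (insert u X) = generated_algebra c X"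
  using generated_algebra_minimal[of "insert u X" c X] generated_algebra_mono[of X "insert u X" c]
  by (auto intro: generated_algebra.incl)

lemma (in adjoin_element) adjoin_generated:
  assumes "A = generated_algebra c X"
  shows "adjoin = generated_algebra c (insert u X)"
proof
  have sub: "A \<subseteq> generated_algebra c (insert u X)"
    unfolding assms by (rule generated_algebra_mono) blast
  have "poly Q u \<in> generated_algebra c (insert u X)" if "\<And>i. coeff Q i \<in> A" for Q
    using that
  proof (induction Q)
    case 0
    thus ?case using generated_algebra.const[of c 0] by (simp add: c.hom_zero)
  next
    case (pCons a Q)
    have "a \<in> A" using pCons.prems[of 0] by simp
    moreover have "coeff Q i \<in> A" for i using pCons.prems[of "Suc i"] by simp
    ultimately show ?case using pCons.IH sub
      by (auto intro!: generated_algebra.add generated_algebra.mult intro: generated_algebra.incl)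
  qed
  thus "adjoin \<subseteq> generated_algebra c (insert u X)" by (auto simp: adjoin_def)
  show "generated_algebra c (insert u X) \<subseteq> adjoin"
  proof
    fix x assume "x \<in> generated_algebra c (insert u X)"
    thus "x \<in> adjoin"
    proof induction
      case (const a)
      thus ?case using A_sub_adjoin const_A by blast
    next
      case (incl s)
      thus ?case using u_adjoin A_sub_adjoin generated_algebra.incl[of s X c] assms by blast
    qed (auto intro: adjoin_add adjoin_mult)
  qed
qed

context hasse_algebra
begin

definition low :: "nat \<Rightarrow> 'r set" where
  "low d = (\<Union>m<d. G m)"

lemma adjoin_elementI:
  "admissible_subalgebra c G T d A \<Longrightarrow> d > 0 \<Longrightarrow> u \<in> G d \<Longrightarrow> u \<notin> A \<Longrightarrow> adjoin_element c G T d A u"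
  by (simp add: adjoin_element_def adjoin_element_axioms_def)

lemma admissible_insert:
  assumes "admissible_subalgebra c G T d (generated_algebra c X)" "d > 0" "u \<in> G d"
  shows "admissible_subalgebra c G T d (generated_algebra c (insert u X))"
proof (cases "u \<in> generated_algebra c X")
  case True
  thus ?thesis using assms generated_algebra_insert_redundant by metis
next
  case False
  then interpret adjoin_element c G T d "generated_algebra c X" u
    using assms by (intro adjoin_elementI)
  show ?thesis using admissible_adjoin adjoin_generated[OF refl] by simp
qed

lemma admissible_union_finite:
  assumes "admissible_subalgebra c G T d (generated_algebra c X)" "d > 0" "finite F" "F \<subseteq> G d"
  shows "admissible_subalgebra c G T d (generated_algebra c (X \<union> F))"
  using assms(3,4)
proof (induction F)
  case (insert u F)
  thus ?case using admissible_insert[of d "X \<union> F" u] assms(2) by simp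
qed (use assms(1) in simp)

lemma generated_low_1: "generated_algebra c (low 1) = range c"
proof
  show "generated_algebra c (low 1) \<subseteq> range c"
  proof
    fix x assume "x \<in> generated_algebra c (low 1)"
    thus "x \<in> range c"
    proof induction
      case (incl s)
      thus ?case using c_bij by (auto simp: low_def bij_betw_def)
    qed (auto simp flip: c_add c_mult)
  qed
qed (auto intro: generated_algebra.const)

text \<open>Elements of degree below \<open>d + 1\<close> are generated by those of degree below \<open>d\<close> together with
  \<open>G d\<close>. Every condition on an admissible subalgebra concerns one element at a time, which
  involves only finitely many elements of \<open>G d\<close>, and these can be adjoined successively.\<close>

lemma admissible_low:
  assumes "d > 0"
  shows "admissible_subalgebra c G T d (generated_algebra c (low d))"
  using assms
proof (induction d rule: nat_induct_non_zero)
  case 1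
  show ?case unfolding generated_low_1
  proof
    fix x y assume "x \<in> range c" "y \<in> range c"
    thus "x + y \<in> range c" "x * y \<in> range c" by (auto simp flip: c_add c_mult)
  next
    fix n x assume "x \<in> range c"
    then obtain a where "x = c a" by blast
    hence "component n x = c (if n = 0 then a else 0)" using component_hom[OF c_mem] by (simp add: c.hom_zero)
    thus "component n x \<in> range c" by blast
  next
    fix j x r assume "x \<in> range c"
    then obtain a where "x = c a" by blast
    hence "coeff (T j x) r = c (if r = 0 then a else 0)"
      by (simp add: T_const c.hom_zero coeff_pCons split: nat.split)
    thus "coeff (T j x) r \<in> range c" by blast
  next
    show "G m \<subseteq> range c" if "m < 1" for m using c_bij that by (auto simp: bij_betw_def)
    show "root_closed (range c)"
      unfolding root_closed_def
    proof (intro impI allI ballI)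
      fix B M g b
      assume p: "prime CHAR('k)" and B: "finite B" "frobenius_independent B" and g: "\<forall>b\<in>B. g b \<in> G M"
        and s: "(\<Sum>b\<in>B. c b * g b ^ CHAR('k)) \<in> range c" and b: "b \<in> B"
      show "g b \<in> range c"
      proof (cases "M = 0")
        case True
        thus ?thesis using g b c_bij by (auto simp: bij_betw_def)
      next
        case False
        let ?s = "\<Sum>b\<in>B. c b * g b ^ CHAR('k)"
        have "c b * g b ^ CHAR('k) \<in> G (M * CHAR('k))" if "b \<in> B" for b
          using mult_mem[OF c_mem power_mem[of "g b" M]] g that by simp
        hence "?s \<in> G (M * CHAR('k))" by (rule sum_mem)
        moreover have "M * CHAR('k) \<noteq> 0" using False p prime_gt_0_nat[OF p] by simp
        ultimately have "component 0 ?s = 0" using component_hom by simp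
        moreover have "component 0 ?s = ?s" using s component_hom[OF c_mem, of 0] by auto
        ultimately have "g b = 0" using frobenius_sum_eq_0[OF p B g] b by simp
        thus ?thesis using c.hom_zero by (metis rangeI)
      qed
    qed
  qed (auto simp: hasse_algebra_axioms)
next
  case (Suc d)
  let ?A = "generated_algebra c (low (Suc d))"
  have low: "low (Suc d) = low d \<union> G d" by (auto simp: low_def less_Suc_eq)
  have sub: "generated_algebra c (low d \<union> F) \<subseteq> ?A" if "F \<subseteq> G d" for F
    by (rule generated_algebra_mono) (use that low in auto)
  have fin: "\<exists>F. F \<subseteq> G d \<and> x \<in> generated_algebra c (low d \<union> F) \<and>
      admissible_subalgebra c G T d (generated_algebra c (low d \<union> F))" if "x \<in> ?A" for x
    using generated_algebra_finitary[of x c "low d" "G d"] that low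
      admissible_union_finite[OF Suc.IH Suc.hyps] by metis
  show ?case
  proof
    fix x y assume "x \<in> ?A" "y \<in> ?A"
    thus "x + y \<in> ?A" "x * y \<in> ?A" by (auto intro: generated_algebra.intros)
  next
    fix n x assume "x \<in> ?A"
    then obtain F where F: "F \<subseteq> G d" "x \<in> generated_algebra c (low d \<union> F)"
      "admissible_subalgebra c G T d (generated_algebra c (low d \<union> F))" using fin by blast
    show "component n x \<in> ?A"
      using admissible_subalgebra.component_A[OF F(3,2)] sub[OF F(1)] by (rule rev_subsetD)
  next
    fix j x r assume "x \<in> ?A"
    then obtain F where F: "F \<subseteq> G d" "x \<in> generated_algebra c (low d \<union> F)"
      "admissible_subalgebra c G T d (generated_algebra c (low d \<union> F))" using fin by blast
    show "coeff (T j x) r \<in> ?A"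
      using admissible_subalgebra.taylor_A[OF F(3,2)] sub[OF F(1)] by (rule rev_subsetD)
  next
    show "c a \<in> ?A" for a by (rule generated_algebra.const)
    show "G m \<subseteq> ?A" if "m < Suc d" for m
      using that by (auto simp: low_def intro!: generated_algebra.incl)
    show "root_closed ?A"
      unfolding root_closed_def
    proof (intro impI allI ballI)
      fix B M g b
      assume p: "prime CHAR('k)" and B: "finite B" "frobenius_independent B" and g: "\<forall>b\<in>B. g b \<in> G M"
        and s: "(\<Sum>b\<in>B. c b * g b ^ CHAR('k)) \<in> ?A" and b: "b \<in> B"
      from fin[OF s] obtain F where F: "F \<subseteq> G d"
        "(\<Sum>b\<in>B. c b * g b ^ CHAR('k)) \<in> generated_algebra c (low d \<union> F)"
        "admissible_subalgebra c G T d (generated_algebra c (low d \<union> F))" by blast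
      have "g b \<in> generated_algebra c (low d \<union> F)"
        by (rule root_closedD[OF admissible_subalgebra.roots_A[OF F(3)] p B _ F(2) b]) (use g in auto)
      thus "g b \<in> ?A" using sub[OF F(1)] by blast
    qed
  qed
qed

lemma admissible_low_union:
  "d > 0 \<Longrightarrow> finite F \<Longrightarrow> F \<subseteq> G d \<Longrightarrow> admissible_subalgebra c G T d (generated_algebra c (low d \<union> F))"
  by (intro admissible_union_finite admissible_low)


section \<open>Minimal homogeneous generators\<close>

sublocale V: vector_space "\<lambda>a x. c a * x"
  by unfold_locales (auto simp: algebra_simps c_add c_mult c_one)

lemma subspace_generated: "V.subspace (generated_algebra c X)"
  using generated_algebra.const[of c 0] by (auto simp: V.subspace_def c.hom_zero intro: generated_algebra.intros)

text \<open>Adjoining elements of degree \<open>d\<close> enlarges the part of degree \<open>d\<close> only by their linear span;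
  so linear independence modulo what lower degrees generate is enough for a new element to lie
  outside the subalgebra reached so far.\<close>

lemma generated_degree_part:
  assumes d: "d > 0" and F: "finite F" "F \<subseteq> G d"
  shows "generated_algebra c (low d \<union> F) \<inter> G d \<subseteq> V.span (generated_algebra c (low d) \<inter> G d \<union> F)"
  using F
proof (induction F)
  case empty
  show ?case by (auto intro: V.span_base)
next
  case (insert u F)
  let ?U = "generated_algebra c (low d) \<inter> G d"
  let ?A = "generated_algebra c (low d \<union> F)"
  have mono: "V.span (?U \<union> F) \<subseteq> V.span (?U \<union> insert u F)" by (rule V.span_mono) auto
  show ?case
  proof (cases "u \<in> ?A")
    case True
    thus ?thesis using insert mono generated_algebra_insert_redundant[OF True] by auto
  next
    case False
    interpret adjoin_element c G T d ?A u
      using False insert.prems insert.hyps d by (intro adjoin_elementI admissible_low_union) auto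
    have eq: "adjoin = generated_algebra c (low d \<union> insert u F)"
      using adjoin_generated[OF refl] by simp
    show ?thesis
    proof
      fix x assume x: "x \<in> generated_algebra c (low d \<union> insert u F) \<inter> G d"
      then obtain Q where Q: "x = poly Q u" "hom.weighted d (int d) Q"
        using adjoin_homE[of x d] eq by blast
      have Qi: "coeff Q i \<in> ?A \<inter> Gz (int d - int (d * i))" for i
        using Q(2) by (simp add: hom.weighted_def)
      have "degree Q \<le> 1"
      proof (rule degree_le, intro allI impI)
        fix i :: nat assume "1 < i"
        hence "d * 1 < d * i" using d_pos by (intro mult_strict_left_mono) auto
        hence "int d - int (d * i) < 0" by linarith
        thus "coeff Q i = 0" using Qi[of i] Gz_neg by blast
      qed
      hence "x = coeff Q 0 + coeff Q 1 * u"
        unfolding Q(1) by (cases "degree Q") (auto simp: poly_altdef coeff_eq_0)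
      moreover have "coeff Q 0 \<in> V.span (?U \<union> insert u F)"
        using Qi[of 0] insert mono by auto
      moreover have "coeff Q 1 \<in> G 0" using Qi[of 1] by (simp add: Gz_def)
      then obtain a where "coeff Q 1 = c a" by (rule G0_E)
      moreover have "u \<in> V.span (?U \<union> insert u F)" by (rule V.span_base) simp
      ultimately show "x \<in> V.span (?U \<union> insert u F)"
        using V.span_add V.span_scale by simp
    qed
  qed
qed

lemma minimal_generators:
  assumes d: "d > 0"
  obtains S where "S \<subseteq> G d" "G d \<subseteq> V.span (generated_algebra c (low d) \<inter> G d \<union> S)"
    "\<And>u F. u \<in> S \<Longrightarrow> finite F \<Longrightarrow> F \<subseteq> S - {u} \<Longrightarrow> u \<notin> generated_algebra c (low d \<union> F)"
proof -
  let ?U = "generated_algebra c (low d) \<inter> G d"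
  obtain B0 where B0: "B0 \<subseteq> ?U" "V.independent B0" "?U \<subseteq> V.span B0"
    by (rule V.maximal_independent_subset)
  have "B0 \<subseteq> G d" using B0(1) by blast
  then obtain B1 where B1: "B0 \<subseteq> B1" "B1 \<subseteq> G d" "V.independent B1" "G d \<subseteq> V.span B1"
    using V.maximal_independent_subset_extend[OF _ B0(2)] by blast
  show ?thesis
  proof (rule that[of "B1 - B0"])
    show "B1 - B0 \<subseteq> G d" using B1 by blast
    have "V.span B1 \<subseteq> V.span (?U \<union> (B1 - B0))" by (rule V.span_mono) (use B0 in blast)
    thus "G d \<subseteq> V.span (?U \<union> (B1 - B0))" using B1(4) by blast
    fix u F assume u: "u \<in> B1 - B0" and F: "finite F" "F \<subseteq> B1 - B0 - {u}"
    show "u \<notin> generated_algebra c (low d \<union> F)"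
    proof
      assume "u \<in> generated_algebra c (low d \<union> F)"
      moreover have "F \<subseteq> G d" using F B1 by blast
      ultimately have "u \<in> V.span (?U \<union> F)"
        using generated_degree_part[OF d F(1)] u B1 by blast
      also have "V.span (?U \<union> F) \<subseteq> V.span (B1 - {u})"
      proof (rule V.span_minimal)
        have "V.span B0 \<subseteq> V.span (B1 - {u})" by (rule V.span_mono) (use B1 u in blast)
        moreover have "F \<subseteq> V.span (B1 - {u})" using F V.span_superset by blast
        ultimately show "?U \<union> F \<subseteq> V.span (B1 - {u})" using B0(3) by blast
      qed (rule V.subspace_span)
      finally show False using B1(3) u unfolding V.dependent_def by blast
    qed
  qed
qed

lemma mon_eval_mem_generated:
  assumes "Poly_Mapping.keys m \<subseteq> generated_algebra c X"
  shows "mon_eval (\<lambda>s. s) m \<in> generated_algebra c X"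
proof -
  have one: "1 \<in> generated_algebra c X" using generated_algebra.const[of c 1] by (simp add: c_one)
  have pow: "x ^ n \<in> generated_algebra c X" if "x \<in> generated_algebra c X" for x n
    using that by (induction n) (auto simp: one intro: generated_algebra.mult)
  have "(\<Prod>i\<in>I. i ^ Poly_Mapping.lookup m i) \<in> generated_algebra c X" if "I \<subseteq> Poly_Mapping.keys m" for I
    using that assms by (induction I rule: infinite_finite_induct) (auto simp: one intro!: generated_algebra.mult pow)
  thus ?thesis by (simp add: mon_eval_def)
qed

text \<open>Independence of finitely many generators is proved by removing one, \<open>u\<close>, of highest degree:
  the others lie in an admissible subalgebra over which \<open>u\<close> is transcendental, so a polynomial
  relation can be split according to powers of \<open>u\<close>.\<close>

theorem polynomial_ring: "is_polynomial_ring c G"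
proof -
  have "\<exists>S. \<forall>d>0. S d \<subseteq> G d \<and> G d \<subseteq> V.span (generated_algebra c (low d) \<inter> G d \<union> S d) \<and>
    (\<forall>u F. u \<in> S d \<longrightarrow> finite F \<longrightarrow> F \<subseteq> S d - {u} \<longrightarrow> u \<notin> generated_algebra c (low d \<union> F))"
    by (rule choice) (metis minimal_generators)
  then obtain S where S: "\<And>d. d > 0 \<Longrightarrow> S d \<subseteq> G d"
    and S_span: "\<And>d. d > 0 \<Longrightarrow> G d \<subseteq> V.span (generated_algebra c (low d) \<inter> G d \<union> S d)"
    and S_new: "\<And>d u F. d > 0 \<Longrightarrow> u \<in> S d \<Longrightarrow> finite F \<Longrightarrow> F \<subseteq> S d - {u} \<Longrightarrow>
      u \<notin> generated_algebra c (low d \<union> F)" by metis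
  define X where "X = (\<Union>d\<in>{1..}. S d)"
  have X_hom: "X \<subseteq> (\<Union>d\<in>{1..}. G d)" 
  proof
    fix x assume "x \<in> X"
    then obtain d where "d \<ge> 1" "x \<in> S d" unfolding X_def by blast
    thus "x \<in> (\<Union>d\<in>{1..}. G d)" using S[of d] by auto
  qed
  have G_gen: "G d \<subseteq> generated_algebra c X" for d
  proof (induction d rule: less_induct)
    case (less d)
    show ?case
    proof (cases "d = 0")
      case True
      thus ?thesis by (auto elim!: G0_E intro: generated_algebra.const)
    next
      case False
      have "generated_algebra c (low d) \<subseteq> generated_algebra c X"
        by (rule generated_algebra_minimal) (use less.IH in \<open>auto simp: low_def\<close>)
      moreover have "d \<in> {1..}" using False by simp
      hence "S d \<subseteq> X" unfolding X_def by blast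
      hence "S d \<subseteq> generated_algebra c X" by (auto intro: generated_algebra.incl)
      ultimately have "V.span (generated_algebra c (low d) \<inter> G d \<union> S d) \<subseteq> generated_algebra c X"
        by (intro V.span_minimal subspace_generated) blast
      thus ?thesis using S_span[of d] False by blast
    qed
  qed
  have X_gen: "generated_algebra c X = UNIV"
  proof -
    have "x \<in> generated_algebra c X" for x
      by (subst component_props(3)[of x], rule V.subspace_sum[OF subspace_generated])
         (use G_gen component_props(1) in blast)
    thus ?thesis by blast
  qed
  have indep: "p = 0" if "finite F" "F \<subseteq> X" "\<And>m. m \<in> Poly_Mapping.keys p \<Longrightarrow> Poly_Mapping.keys m \<subseteq> F"
      "poly_eval c (\<lambda>s. s) p = 0" for F and p :: "('r \<Rightarrow>\<^sub>0 nat) \<Rightarrow>\<^sub>0 'k"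
    using that
  proof (induction F arbitrary: p rule: finite_psubset_induct)
    case (psubset F)
    show ?case
    proof (cases "F = {}")
      case True
      have p: "p = Poly_Mapping.single 0 (Poly_Mapping.lookup p 0)"
      proof (rule poly_mapping_eqI)
        fix m
        show "Poly_Mapping.lookup p m = Poly_Mapping.lookup (Poly_Mapping.single 0 (Poly_Mapping.lookup p 0)) m"
          using psubset.prems(2)[of m] True by (cases "m = 0") (auto simp: lookup_single in_keys_iff)
      qed
      have "c (Poly_Mapping.lookup p 0) = 0"
        using psubset.prems(3) by (subst (asm) p) (simp add: c.poly_eval_single)
      hence "Poly_Mapping.lookup p 0 = 0" by (simp add: c_eq_0)
      thus ?thesis using p by simp
    next
      case False
      have "\<forall>s\<in>F. \<exists>d>0. s \<in> S d" 
      proof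
        fix s assume "s \<in> F"
        then obtain d where "d \<ge> 1" "s \<in> S d" using psubset.prems(1) unfolding X_def by blast
        thus "\<exists>d>0. s \<in> S d" by (intro exI[of _ d]) simp
      qed
      then obtain dg where dg: "\<And>s. s \<in> F \<Longrightarrow> dg s > 0 \<and> s \<in> S (dg s)" by metis
      obtain u where u: "u \<in> F" "\<And>s. s \<in> F \<Longrightarrow> dg s \<le> dg u"
      proof -
        have fin: "finite (dg ` F)" "dg ` F \<noteq> {}" using psubset.hyps False by auto
        obtain u where "u \<in> F" "dg u = Max (dg ` F)" using Max_in[OF fin] by auto
        thus ?thesis using that Max_ge[OF fin(1)] by simp
      qed
      define d where "d = dg u"
      have d: "d > 0" "u \<in> S d" using dg[OF u(1)] by (auto simp: d_def)
      define F' where "F' = {s \<in> F. dg s = d} - {u}"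
      have F': "finite F'" "F' \<subseteq> S d - {u}" using psubset.hyps dg by (auto simp: F'_def)
      let ?A = "generated_algebra c (low d \<union> F')"
      interpret adjoin_element c G T d ?A u
        using d F' S[OF d(1)] S_new[OF d F'] by (intro adjoin_elementI admissible_low_union) auto
      have F_A: "F - {u} \<subseteq> ?A"
      proof
        fix s assume s: "s \<in> F - {u}"
        have "s \<in> low d \<union> F'"
        proof (cases "dg s = d")
          case True
          thus ?thesis using s by (simp add: F'_def)
        next
          case False
          hence "dg s < d" using u(2)[of s] s by (simp add: d_def)
          thus ?thesis using dg[of s] S[of "dg s"] s by (auto simp: low_def)
        qed
        thus "s \<in> ?A" by (rule generated_algebra.incl)
      qed
      define ex where "ex m = Poly_Mapping.lookup m u" for m :: "'r \<Rightarrow>\<^sub>0 nat"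
      define rest where "rest m = m - Poly_Mapping.single u (ex m)" for m
      have m_split: "m = rest m + Poly_Mapping.single u (ex m)" for m
        by (rule poly_mapping_eqI) (simp add: rest_def ex_def lookup_add lookup_minus lookup_single when_def)
      have rest_keys: "Poly_Mapping.keys (rest m) \<subseteq> F - {u}" if "m \<in> Poly_Mapping.keys p" for m
        using psubset.prems(2)[OF that]
        by (auto simp: rest_def ex_def in_keys_iff lookup_minus lookup_single when_def split: if_splits)
      have mon_split: "mon_eval (\<lambda>s. s) m = mon_eval (\<lambda>s. s) (rest m) * u ^ ex m" for m
        by (subst m_split, subst mon_eval_add) (simp add: mon_eval_def)
      define Q where "Q = (\<Sum>m\<in>Poly_Mapping.keys p.
        monom (c (Poly_Mapping.lookup p m) * mon_eval (\<lambda>s. s) (rest m)) (ex m))"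
      have "Q = 0"
      proof (rule transcendental)
        have "poly Q u = poly_eval c (\<lambda>s. s) p"
          by (simp only: Q_def poly_sum poly_monom poly_eval_def mult.assoc mon_split[symmetric])
        thus "poly Q u = 0" using psubset.prems(3) by simp
        fix i
        have "coeff (monom (c (Poly_Mapping.lookup p m) * mon_eval (\<lambda>s. s) (rest m)) (ex m)) i \<in> ?A"
          if "m \<in> Poly_Mapping.keys p" for m
        proof -
          have "mon_eval (\<lambda>s. s) (rest m) \<in> ?A"
            by (rule mon_eval_mem_generated) (use rest_keys[OF that] F_A in blast)
          thus ?thesis using mult_A[OF const_A] zero_A by simp
        qed
        thus "coeff Q i \<in> ?A" unfolding Q_def coeff_sum by (rule sum_A)
      qed
      define P where "P i = (\<Sum>m\<in>{m \<in> Poly_Mapping.keys p. ex m = i}.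
        Poly_Mapping.single (rest m) (Poly_Mapping.lookup p m))" for i
      have P0: "P i = 0" for i
      proof (rule psubset.IH[of "F - {u}"])
        show "F - {u} \<subset> F" "F - {u} \<subseteq> X" using u psubset.prems(1) by auto
        have "poly_eval c (\<lambda>s. s) (P i) = coeff Q i"
          by (auto simp: P_def Q_def c.poly_eval_sum c.poly_eval_single c.poly_eval_zero coeff_sum sum.inter_filter intro!: sum.cong)
        thus "poly_eval c (\<lambda>s. s) (P i) = 0" using \<open>Q = 0\<close> by simp
        show "Poly_Mapping.keys m \<subseteq> F - {u}" if "m \<in> Poly_Mapping.keys (P i)" for m
        proof -
          have "Poly_Mapping.keys (P i) \<subseteq> rest ` Poly_Mapping.keys p"
            unfolding P_def by (rule order.trans[OF keys_sum]) (auto split: if_splits)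
          thus ?thesis using that rest_keys by blast
        qed
      qed
      show "p = 0"
      proof (rule poly_mapping_eqI)
        fix m
        show "Poly_Mapping.lookup p m = Poly_Mapping.lookup 0 m"
        proof (cases "m \<in> Poly_Mapping.keys p")
          case True
          have "m' = m" if "ex m' = ex m" "rest m' = rest m" for m'
            using m_split[of m'] m_split[of m] that by simp
          hence "Poly_Mapping.lookup (P (ex m)) (rest m) =
            (\<Sum>m'\<in>{m' \<in> Poly_Mapping.keys p. ex m' = ex m}. if m' = m then Poly_Mapping.lookup p m else 0)"
            unfolding P_def lookup_sum by (intro sum.cong refl) (auto simp: lookup_single when_def)
          also have "\<dots> = Poly_Mapping.lookup p m" using True by simp
          finally show ?thesis using P0 by simp
        qed (simp add: in_keys_iff)
      qed
    qed
  qed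
  have "alg_independent c X"
    unfolding alg_independent_def
  proof (intro allI impI)
    fix p :: "('r \<Rightarrow>\<^sub>0 nat) \<Rightarrow>\<^sub>0 'k"
    assume k: "\<forall>m\<in>Poly_Mapping.keys p. Poly_Mapping.keys m \<subseteq> X" and "poly_eval c (\<lambda>s. s) p = 0"
    thus "p = 0" by (intro indep[of "\<Union>m\<in>Poly_Mapping.keys p. Poly_Mapping.keys m" p]) auto
  qed
  thus ?thesis
    unfolding is_polynomial_ring_def using X_hom X_gen connected_graded_algebra_axioms by blast
qed

end


section \<open>Coefficients of elements of the limit\<close>

lemma lookup_proj_nonzero_keys: "Poly_Mapping.lookup (proj x n) m \<noteq> 0 \<Longrightarrow> Poly_Mapping.keys m \<subseteq> {..n}"
  using proj[of x] unfolding limit_carrier_iff by blast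

text \<open>An element of the limit is determined by its coefficients, and the coefficient of \<open>m\<close> can be
  read off at any stage that contains the variables of \<open>m\<close>. Conversely any family of coefficients
  of bounded degree occurs (\<open>coef_of_coef\<close>).\<close>

definition coef :: "'k::field graded_limit \<Rightarrow> (nat \<Rightarrow>\<^sub>0 nat) \<Rightarrow> 'k" where
  "coef x m = Poly_Mapping.lookup (proj x (Max (insert 0 (Poly_Mapping.keys m)))) m"

lemma lookup_proj:
  "Poly_Mapping.lookup (proj x n) m = (if Poly_Mapping.keys m \<subseteq> {..n} then coef x m else 0)"
proof (cases "Poly_Mapping.keys m \<subseteq> {..n}")
  case True
  define N where "N = Max (insert 0 (Poly_Mapping.keys m))"
  have keys_N: "Poly_Mapping.keys m \<subseteq> {..N}" by (auto simp: N_def)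
  have "N \<le> n" using True by (auto simp: N_def)
  hence "Poly_Mapping.lookup (proj x n) m = Poly_Mapping.lookup (proj x N) m"
  proof (induction n rule: dec_induct)
    case (step n)
    hence "Poly_Mapping.lookup m (Suc n) = 0" using keys_N by (force simp: in_keys_iff)
    thus ?case using lookup_transition[of n "proj x (Suc n)" m] step.IH by (simp add: transition_proj)
  qed simp
  thus ?thesis using True by (simp add: coef_def N_def)
qed (use lookup_proj_nonzero_keys in auto)

lemma coef_eqI: "(\<And>m. coef x m = coef y m) \<Longrightarrow> x = y"
  by (rule graded_limit_eqI) (simp add: lookup_proj)

lemma coef_conv_proj: "Poly_Mapping.keys m \<subseteq> {..n} \<Longrightarrow> coef x m = Poly_Mapping.lookup (proj x n) m"
  by (simp add: lookup_proj)

lemma keys_bounded: "\<exists>n\<ge>N. Poly_Mapping.keys (m :: nat \<Rightarrow>\<^sub>0 nat) \<subseteq> {..n}"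
  by (rule exI[of _ "Max (insert N (Poly_Mapping.keys m))"]) auto

lemma eventually_proj_eqI: "(\<And>n. n \<ge> N \<Longrightarrow> proj x n = proj y n) \<Longrightarrow> x = y"
  by (rule coef_eqI) (metis coef_conv_proj keys_bounded)

lemma coef_bounded: "\<exists>D. \<forall>m. coef x m \<noteq> 0 \<longrightarrow> mdeg m \<le> D"
  using proj[of x] unfolding limit_carrier_iff by (metis coef_def)

lemma finite_monomials: "finite {m :: nat \<Rightarrow>\<^sub>0 nat. Poly_Mapping.keys m \<subseteq> {..n} \<and> mdeg m \<le> D}"
proof -
  let ?S = "{f :: nat \<Rightarrow> nat. \<forall>i. (i \<in> {..n} \<longrightarrow> f i \<in> {..D}) \<and> (i \<notin> {..n} \<longrightarrow> f i = 0)}"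
  have "finite ?S" by (rule finite_set_of_finite_funs) auto
  moreover have "inj (Poly_Mapping.lookup :: (nat \<Rightarrow>\<^sub>0 nat) \<Rightarrow> _)"
    by (simp add: inj_def lookup_inject)
  ultimately have "finite (Poly_Mapping.lookup -` ?S)" by (rule finite_vimageI)
  moreover have "{m. Poly_Mapping.keys m \<subseteq> {..n} \<and> mdeg m \<le> D} \<subseteq> Poly_Mapping.lookup -` ?S"
  proof
    fix m :: "nat \<Rightarrow>\<^sub>0 nat" assume m: "m \<in> {m. Poly_Mapping.keys m \<subseteq> {..n} \<and> mdeg m \<le> D}"
    have "Poly_Mapping.lookup m i \<le> mdeg m" for i
      by (cases "i \<in> Poly_Mapping.keys m") (auto simp: mdeg_def in_keys_iff intro: member_le_sum)
    hence "Poly_Mapping.lookup m i \<le> D" for i using m order.trans by blast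
    moreover have "Poly_Mapping.lookup m i = 0" if "i \<notin> {..n}" for i
      using m that by (auto simp: in_keys_iff)
    ultimately show "m \<in> Poly_Mapping.lookup -` ?S" by simp
  qed
  ultimately show ?thesis using finite_subset by blast
qed

definition of_coef :: "((nat \<Rightarrow>\<^sub>0 nat) \<Rightarrow> 'k::field) \<Rightarrow> 'k graded_limit" where
  "of_coef a = Abs_graded_limit (\<lambda>n. Abs_poly_mapping (\<lambda>m. a m when Poly_Mapping.keys m \<subseteq> {..n}))"

lemma coef_of_coef:
  assumes D: "\<And>m. a m \<noteq> 0 \<Longrightarrow> mdeg m \<le> D"
  shows "coef (of_coef a) = a"
proof -
  define f where "f n = Abs_poly_mapping (\<lambda>m. a m when Poly_Mapping.keys m \<subseteq> {..n})" for n
  have f: "Poly_Mapping.lookup (f n) m = (a m when Poly_Mapping.keys m \<subseteq> {..n})" for n m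
  proof -
    have "finite {m. (a m when Poly_Mapping.keys m \<subseteq> {..n}) \<noteq> 0}"
      by (rule finite_subset[OF _ finite_monomials[of n D]]) (use D in auto)
    thus ?thesis by (simp add: f_def)
  qed
  have "f \<in> limit_carrier"
    unfolding limit_carrier_iff
  proof (intro conjI allI exI[of _ D] impI)
    fix n
    show "transition n (f (Suc n)) = f n"
    proof (rule poly_mapping_eqI)
      fix m :: "nat \<Rightarrow>\<^sub>0 nat"
      have "Poly_Mapping.lookup m (Suc n) = 0 \<and> Poly_Mapping.keys m \<subseteq> {..Suc n} \<longleftrightarrow> Poly_Mapping.keys m \<subseteq> {..n}"
        by (auto simp: subset_iff in_keys_iff le_Suc_eq) (metis less_irrefl)
      thus "Poly_Mapping.lookup (transition n (f (Suc n))) m = Poly_Mapping.lookup (f n) m"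
        by (auto simp: lookup_transition f when_def)
    qed
  qed (use D in \<open>auto simp: f when_def split: if_splits\<close>)
  hence "proj (of_coef a) = f" by (simp add: of_coef_def f_def[abs_def, symmetric] Abs_graded_limit_inverse)
  thus ?thesis by (intro ext) (auto simp: coef_def f when_def)
qed

lemma coef_add: "coef (x + y) m = coef x m + coef y m"
  by (simp add: coef_def proj_simps lookup_add)

lemma coef_zero: "coef 0 m = 0"
  by (simp add: coef_def proj_simps)

lemma coef_sum: "coef (sum f I) m = (\<Sum>i\<in>I. coef (f i) m)"
  by (induction I rule: infinite_finite_induct) (auto simp: coef_add coef_zero)

lemma coef_const: "coef (limit_of_const a) m = (if m = 0 then a else 0)"
  by (auto simp: coef_def limit_of_const.rep_eq poly_const_def lookup_single when_def)

lemma coef_scale: "coef (limit_of_const a * x) m = a * coef x m"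
  by (simp add: coef_def proj_simps limit_of_const.rep_eq poly_const_def
      mult_map_scale_conv_mult[symmetric] Poly_Mapping.map.rep_eq when_def)

lemma limit_grading_coef: "x \<in> limit_grading d \<longleftrightarrow> (\<forall>m. coef x m \<noteq> 0 \<longrightarrow> mdeg m = d)"
  unfolding limit_grading_iff lookup_proj by (metis coef_def lookup_proj)


section \<open>Hasse derivatives\<close>

lemma mdeg_single: "mdeg (Poly_Mapping.single j r) = r"
  by (simp add: mdeg_def)

lemma add_diff_single:
  "r \<le> Poly_Mapping.lookup m j \<Longrightarrow> m - Poly_Mapping.single j r + Poly_Mapping.single j r = (m :: 'i \<Rightarrow>\<^sub>0 nat)"
  by (rule poly_mapping_eqI) (auto simp: lookup_add lookup_minus lookup_single when_def)

definition hasse_poly :: "nat \<Rightarrow> nat \<Rightarrow> 'k::field mpoly \<Rightarrow> 'k mpoly" where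
  "hasse_poly j r p = (\<Sum>m\<in>Poly_Mapping.keys p. Poly_Mapping.single (m - Poly_Mapping.single j r)
     (of_nat (Poly_Mapping.lookup m j choose r) * Poly_Mapping.lookup p m))"

lemma lookup_hasse_poly:
  "Poly_Mapping.lookup (hasse_poly j r p) m =
     of_nat ((Poly_Mapping.lookup m j + r) choose r) * Poly_Mapping.lookup p (m + Poly_Mapping.single j r)"
proof -
  let ?m = "m + Poly_Mapping.single j r"
  have "Poly_Mapping.lookup (Poly_Mapping.single (m' - Poly_Mapping.single j r)
     (of_nat (Poly_Mapping.lookup m' j choose r) * Poly_Mapping.lookup p m')) m =
     (if m' = ?m then of_nat ((Poly_Mapping.lookup m j + r) choose r) * Poly_Mapping.lookup p ?m else 0)" for m'
  proof (cases "Poly_Mapping.lookup m' j < r")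
    case True
    hence "m' \<noteq> ?m" by (auto simp: lookup_add)
    thus ?thesis using True by (simp add: binomial_eq_0)
  next
    case False
    hence "m' - Poly_Mapping.single j r = m \<longleftrightarrow> m' = ?m" using add_diff_single[of r m' j] by auto
    thus ?thesis by (auto simp: lookup_single when_def lookup_add)
  qed
  thus ?thesis
    by (auto simp: hasse_poly_def lookup_sum in_keys_iff)
qed

lemma hasse_poly_add: "hasse_poly j r (p + q) = hasse_poly j r p + hasse_poly j r q"
  by (rule poly_mapping_eqI) (simp add: lookup_hasse_poly lookup_add algebra_simps)

lemma hasse_poly_single:
  "hasse_poly j r (Poly_Mapping.single m a) =
     Poly_Mapping.single (m - Poly_Mapping.single j r) (of_nat (Poly_Mapping.lookup m j choose r) * a)"
  by (cases "a = 0") (auto simp: hasse_poly_def)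

lemma poly_mapping_additive_induct:
  fixes P :: "('a \<Rightarrow>\<^sub>0 'b::comm_monoid_add) \<Rightarrow> bool"
  assumes "P 0" "\<And>m a. P (Poly_Mapping.single m a)" "\<And>p q. P p \<Longrightarrow> P q \<Longrightarrow> P (p + q)"
  shows "P p"
proof -
  have "P (\<Sum>m\<in>A. Poly_Mapping.single m (Poly_Mapping.lookup p m))" for A
    by (induction A rule: infinite_finite_induct) (auto intro: assms)
  thus ?thesis using poly_mapping_sum_singles[of p] by metis
qed

lemma hasse_poly_mult:
  "hasse_poly j r (p * q) = (\<Sum>k\<le>r. hasse_poly j k p * hasse_poly j (r - k) q)"
proof (induction p rule: poly_mapping_additive_induct)
  case 1
  thus ?case by (simp add: hasse_poly_def)
next
  case (2 m a)
  show ?case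
  proof (induction q rule: poly_mapping_additive_induct)
    case 1
    thus ?case by (simp add: hasse_poly_def)
  next
    case (2 m' b)
    let ?c = "\<lambda>m k. Poly_Mapping.lookup m j choose k"
    have "hasse_poly j k (Poly_Mapping.single m a) * hasse_poly j (r - k) (Poly_Mapping.single m' b) =
       Poly_Mapping.single (m + m' - Poly_Mapping.single j r) (of_nat (?c m k * ?c m' (r - k)) * (a * b))"
      if "k \<le> r" for k
    proof (cases "k \<le> Poly_Mapping.lookup m j \<and> r - k \<le> Poly_Mapping.lookup m' j")
      case True
      have "m - Poly_Mapping.single j k + (m' - Poly_Mapping.single j (r - k)) = m + m' - Poly_Mapping.single j r"
        by (rule poly_mapping_eqI) (use True that in \<open>auto simp: lookup_add lookup_minus lookup_single when_def\<close>)
      thus ?thesis by (simp add: hasse_poly_single mult_single mult_ac)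
    next
      case False
      hence "Poly_Mapping.lookup m j < k \<or> Poly_Mapping.lookup m' j < r - k" by auto
      thus ?thesis by (elim disjE) (simp_all add: hasse_poly_single binomial_eq_0)
    qed
    hence "(\<Sum>k\<le>r. hasse_poly j k (Poly_Mapping.single m a) * hasse_poly j (r - k) (Poly_Mapping.single m' b))
      = (\<Sum>k\<le>r. Poly_Mapping.single (m + m' - Poly_Mapping.single j r) (of_nat (?c m k * ?c m' (r - k)) * (a * b)))"
      by simp
    also have "\<dots> = Poly_Mapping.single (m + m' - Poly_Mapping.single j r)
        (of_nat (\<Sum>k\<le>r. ?c m k * ?c m' (r - k)) * (a * b))"
      by (rule poly_mapping_eqI) (simp add: lookup_sum lookup_single when_def sum_distrib_right)
    also have "\<dots> = hasse_poly j r (Poly_Mapping.single m a * Poly_Mapping.single m' b)"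
      by (simp add: vandermonde mult_single hasse_poly_single lookup_add)
    finally show ?case by simp
  next
    case (3 p q)
    thus ?case by (simp add: distrib_left hasse_poly_add sum.distrib)
  qed
next
  case (3 p q)
  thus ?case by (simp add: distrib_right hasse_poly_add sum.distrib)
qed

definition hasse :: "nat \<Rightarrow> nat \<Rightarrow> 'k::field graded_limit \<Rightarrow> 'k graded_limit" where
  "hasse j r x = of_coef (\<lambda>m. of_nat ((Poly_Mapping.lookup m j + r) choose r) *
     coef x (m + Poly_Mapping.single j r))"

lemma coef_hasse:
  "coef (hasse j r x) m =
     of_nat ((Poly_Mapping.lookup m j + r) choose r) * coef x (m + Poly_Mapping.single j r)"
proof -
  obtain D where D: "\<And>m. coef x m \<noteq> 0 \<Longrightarrow> mdeg m \<le> D" using coef_bounded by blast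
  have "coef (hasse j r x) = (\<lambda>m. of_nat ((Poly_Mapping.lookup m j + r) choose r) *
     coef x (m + Poly_Mapping.single j r))"
    unfolding hasse_def
  proof (rule coef_of_coef)
    fix m assume "of_nat ((Poly_Mapping.lookup m j + r) choose r) * coef x (m + Poly_Mapping.single j r) \<noteq> 0"
    thus "mdeg m \<le> D" using D[of "m + Poly_Mapping.single j r"] by (auto simp: mdeg_add)
  qed
  thus ?thesis by simp
qed

text \<open>The derivative of full order in \<open>x\<^sub>j\<close> recovers the coefficient of \<open>m\<close> without a binomial
  factor; this is why Hasse derivatives work in every characteristic.\<close>

lemma coef_hasse_top:
  "coef (hasse j (Poly_Mapping.lookup m j) x) (m - Poly_Mapping.single j (Poly_Mapping.lookup m j)) = coef x m"
  by (simp add: coef_hasse add_diff_single lookup_minus)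

text \<open>Only at stages \<open>n \<ge> j\<close> is the derivative of the projection the projection of the derivative:
  earlier ones do not contain \<open>x\<^sub>j\<close>. These stages determine an element, and so the Leibniz rule can
  be checked on polynomials.\<close>

lemma proj_hasse: "j \<le> n \<Longrightarrow> proj (hasse j r x) n = hasse_poly j r (proj x n)"
proof (rule poly_mapping_eqI)
  fix m assume j: "j \<le> n"
  have "Poly_Mapping.keys (m + Poly_Mapping.single j r) \<subseteq> {..n} \<longleftrightarrow> Poly_Mapping.keys m \<subseteq> {..n}"
    using j by (auto simp: subset_iff in_keys_iff lookup_add lookup_single when_def split: if_splits)
  thus "Poly_Mapping.lookup (proj (hasse j r x) n) m = Poly_Mapping.lookup (hasse_poly j r (proj x n)) m"
    by (simp add: lookup_proj lookup_hasse_poly coef_hasse)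
qed

lemma hasse_mult: "hasse j r (x * y) = (\<Sum>k\<le>r. hasse j k x * hasse j (r - k) y)"
  by (rule eventually_proj_eqI[of j]) (simp add: proj_hasse proj_simps proj_sum hasse_poly_mult)

lemma hasse_zero [simp]: "hasse j 0 x = x"
  by (rule coef_eqI) (simp add: coef_hasse)

definition taylor_expansion :: "nat \<Rightarrow> 'k::field graded_limit \<Rightarrow> 'k graded_limit poly" where
  "taylor_expansion j x = Abs_poly (\<lambda>r. hasse j r x)"

lemma coeff_taylor_expansion: "coeff (taylor_expansion j x) r = hasse j r x"
proof -
  obtain D where D: "\<And>m. coef x m \<noteq> 0 \<Longrightarrow> mdeg m \<le> D" using coef_bounded by blast
  have "hasse j r x = 0" if "r > D" for r
  proof (rule coef_eqI)
    fix m
    have "coef x (m + Poly_Mapping.single j r) = 0"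
      using D[of "m + Poly_Mapping.single j r"] that by (force simp: mdeg_add mdeg_single)
    thus "coef (hasse j r x) m = coef 0 m" by (simp add: coef_hasse coef_zero)
  qed
  hence "coeff (taylor_expansion j x) = (\<lambda>r. hasse j r x)"
    unfolding taylor_expansion_def by (rule coeff_Abs_poly)
  thus ?thesis by simp
qed


section \<open>Frobenius powers in the limit\<close>

definition dilate :: "nat \<Rightarrow> ('i \<Rightarrow>\<^sub>0 nat) \<Rightarrow> 'i \<Rightarrow>\<^sub>0 nat" where
  "dilate p m = Poly_Mapping.map ((*) p) m"

lemma lookup_dilate: "Poly_Mapping.lookup (dilate p m) i = p * Poly_Mapping.lookup m i"
  by (simp add: dilate_def Poly_Mapping.map.rep_eq when_def)

lemma dilate_inj: "p > 0 \<Longrightarrow> dilate p m = dilate p m' \<longleftrightarrow> m = m'"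
  by (auto simp: poly_mapping_eq_iff fun_eq_iff lookup_dilate)

lemma keys_dilate: "p > 0 \<Longrightarrow> Poly_Mapping.keys (dilate p m) = Poly_Mapping.keys m"
  by (auto simp: in_keys_iff lookup_dilate)

lemma mdeg_dilate: "p > 0 \<Longrightarrow> mdeg (dilate p m) = p * mdeg m"
  by (simp add: mdeg_def keys_dilate lookup_dilate sum_distrib_left)

lemma dilate_exI: "(\<And>i. p dvd Poly_Mapping.lookup m i) \<Longrightarrow> \<exists>m'. m = dilate p m'"
  by (rule exI[of _ "Poly_Mapping.map (\<lambda>k. k div p) m"])
     (auto simp: poly_mapping_eq_iff fun_eq_iff lookup_dilate Poly_Mapping.map.rep_eq when_def)

lemma CHAR_mpoly: "CHAR('k::field mpoly) = CHAR('k)"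
proof -
  have "of_nat n = (0 :: 'k mpoly) \<longleftrightarrow> of_nat n = (0 :: 'k)" for n
  proof -
    have eq: "(of_nat n :: 'k mpoly) = Poly_Mapping.single 0 (of_nat n)"
      by (simp only: single_of_nat)
    show ?thesis
    proof
      assume "of_nat n = (0 :: 'k mpoly)"
      thus "of_nat n = (0 :: 'k)" unfolding eq by (metis lookup_single_eq lookup_zero)
    qed (simp add: eq del: single_of_nat)
  qed
  hence "CHAR('k mpoly) dvd n \<longleftrightarrow> CHAR('k) dvd n" for n
    by (simp only: of_nat_eq_0_iff_char_dvd[symmetric])
  thus ?thesis by (metis dvd_antisym dvd_refl)
qed

lemma single_power: "Poly_Mapping.single m a ^ n = Poly_Mapping.single (dilate n m) (a ^ n)"
proof (induction n)
  case 0
  have "dilate 0 m = 0" by (rule poly_mapping_eqI) (simp add: lookup_dilate)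
  thus ?case by simp
next
  case (Suc n)
  have "m + dilate n m = dilate (Suc n) m" by (rule poly_mapping_eqI) (simp add: lookup_dilate lookup_add)
  thus ?case using Suc by (simp add: mult_single)
qed

lemma lookup_frobenius_power:
  fixes q :: "'k::field mpoly"
  assumes p: "prime CHAR('k)"
  shows "Poly_Mapping.lookup (q ^ CHAR('k)) (dilate CHAR('k) m) = Poly_Mapping.lookup q m ^ CHAR('k)"
    and "(\<And>m'. m \<noteq> dilate CHAR('k) m') \<Longrightarrow> Poly_Mapping.lookup (q ^ CHAR('k)) m = 0"
proof -
  let ?p = "CHAR('k)"
  have p0: "?p > 0" using p prime_gt_0_nat by blast
  have "q ^ ?p = (\<Sum>m\<in>Poly_Mapping.keys q. Poly_Mapping.single m (Poly_Mapping.lookup q m)) ^ ?p"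
    using poly_mapping_sum_singles[of q] by simp
  also have "\<dots> = (\<Sum>m\<in>Poly_Mapping.keys q. Poly_Mapping.single m (Poly_Mapping.lookup q m) ^ ?p)"
    by (rule freshmans_dream_sum) (use p in \<open>auto simp: CHAR_mpoly\<close>)
  finally have q: "Poly_Mapping.lookup (q ^ ?p) k =
      (\<Sum>m\<in>Poly_Mapping.keys q. Poly_Mapping.lookup q m ^ ?p when dilate ?p m = k)" for k
    by (simp add: single_power lookup_sum lookup_single)
  show "Poly_Mapping.lookup (q ^ ?p) (dilate ?p m) = Poly_Mapping.lookup q m ^ ?p"
    using p0 by (auto simp: q dilate_inj when_def in_keys_iff power_0_left)
  show "Poly_Mapping.lookup (q ^ ?p) m = 0" if "\<And>m'. m \<noteq> dilate ?p m'"
    unfolding q by (rule sum.neutral) (simp add: that[symmetric])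
qed

lemma proj_power: "proj (x ^ n) k = proj x k ^ n"
  by (induction n) (auto simp: proj_simps)

lemma coef_frobenius_power:
  fixes x :: "'k::field graded_limit"
  assumes p: "prime CHAR('k)"
  shows "coef (x ^ CHAR('k)) (dilate CHAR('k) m) = coef x m ^ CHAR('k)"
    and "(\<And>m'. m \<noteq> dilate CHAR('k) m') \<Longrightarrow> coef (x ^ CHAR('k)) m = 0"
proof -
  have p0: "CHAR('k) > 0" using p prime_gt_0_nat by blast
  show "coef (x ^ CHAR('k)) (dilate CHAR('k) m) = coef x m ^ CHAR('k)"
    unfolding coef_def keys_dilate[OF p0] proj_power by (rule lookup_frobenius_power[OF p])
  show "coef (x ^ CHAR('k)) m = 0" if "\<And>m'. m \<noteq> dilate CHAR('k) m'"
    unfolding coef_def proj_power by (rule lookup_frobenius_power(2)[OF p that])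
qed

lemma coef_frobenius_combination:
  fixes h :: "'k::field \<Rightarrow> 'k graded_limit"
  assumes p: "prime CHAR('k)"
  shows "coef (\<Sum>b\<in>B. limit_of_const b * h b ^ CHAR('k)) (dilate CHAR('k) m) =
      (\<Sum>b\<in>B. b * coef (h b) m ^ CHAR('k))"
    and "(\<And>m'. m \<noteq> dilate CHAR('k) m') \<Longrightarrow>
      coef (\<Sum>b\<in>B. limit_of_const b * h b ^ CHAR('k)) m = 0"
  by (simp_all add: coef_sum coef_scale coef_frobenius_power[OF p])

lemma mdeg_pos_obtain:
  assumes "mdeg m > 0" obtains j where "Poly_Mapping.lookup m j > 0"
  using assms by (metis bot_nat_0.not_eq_extremum lookup_zero mdeg_eq_0 poly_mapping_eqI)

text \<open>Combinations \<open>\<Sum>b\<in>B. b h\<^sub>b\<^sup>p\<close> are exactly the elements all of whose exponents are divisible by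
  \<open>p\<close> and all of whose coefficients lie in the span of \<open>B\<close> over the \<open>p\<close>-th powers; as \<open>B\<close> is one
  fixed finite set, infinitely many coefficients can be treated independently. Both conditions
  concern the coefficient of a single monomial, which occurs in the derivative of full order.\<close>

lemma frobenius_combination_from_hasse:
  fixes x :: "'k::field graded_limit"
  assumes p: "prime CHAR('k)" and M: "M > 0" and x: "x \<in> limit_grading (CHAR('k) * M)"
    and hasse0: "\<And>j r. \<not> CHAR('k) dvd r \<Longrightarrow> hasse j r x = 0"
    and hasse1: "\<And>j r. r > 0 \<Longrightarrow>
      \<exists>h. hasse j (CHAR('k) * r) x = (\<Sum>b\<in>B. limit_of_const b * h b ^ CHAR('k))"
  shows "\<exists>h. (\<forall>b\<in>B. h b \<in> limit_grading M) \<and> x = (\<Sum>b\<in>B. limit_of_const b * h b ^ CHAR('k))"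
proof -
  let ?p = "CHAR('k)"
  have p0: "?p > 0" using p prime_gt_0_nat by blast
  have dvd: "?p dvd Poly_Mapping.lookup m j" if "coef x m \<noteq> 0" for m j
  proof (rule ccontr)
    assume "\<not> ?p dvd Poly_Mapping.lookup m j"
    hence "hasse j (Poly_Mapping.lookup m j) x = 0" by (rule hasse0)
    thus False using coef_hasse_top[of j m x] that by (simp add: coef_zero)
  qed
  have "\<exists>\<delta>. coef x m = (\<Sum>b\<in>B. b * \<delta> b ^ ?p)" if nz: "coef x m \<noteq> 0" for m
  proof -
    have "mdeg m > 0" using x nz M p0 by (simp add: limit_grading_coef)
    then obtain j where j: "Poly_Mapping.lookup m j > 0" by (rule mdeg_pos_obtain)
    obtain r where r: "Poly_Mapping.lookup m j = ?p * r" using dvd[OF nz, of j] by blast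
    obtain h where h: "hasse j (?p * r) x = (\<Sum>b\<in>B. limit_of_const b * h b ^ ?p)"
      using hasse1[of r j] j r by (cases "r = 0") auto
    define k where "k = m - Poly_Mapping.single j (?p * r)"
    have k: "coef x m = coef (\<Sum>b\<in>B. limit_of_const b * h b ^ ?p) k"
      using coef_hasse_top[of j m x] h by (simp add: r k_def)
    show ?thesis
    proof (cases "\<exists>m'. k = dilate ?p m'")
      case True
      then obtain m' where "k = dilate ?p m'" by blast
      thus ?thesis using k coef_frobenius_combination(1)[OF p, of h B m']
        by (intro exI[of _ "\<lambda>b. coef (h b) m'"]) simp
    next
      case False
      thus ?thesis using k nz coef_frobenius_combination(2)[OF p, of k h B] by auto
    qed
  qed
  then obtain \<delta> where \<delta>: "\<And>m. coef x m \<noteq> 0 \<Longrightarrow> coef x m = (\<Sum>b\<in>B. b * \<delta> m b ^ ?p)" by metis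
  define a where "a b m = (if coef x (dilate ?p m) \<noteq> 0 then \<delta> (dilate ?p m) b else 0)" for b m
  have a_deg: "mdeg m = M" if "a b m \<noteq> 0" for b m
  proof -
    have "coef x (dilate ?p m) \<noteq> 0" using that by (auto simp: a_def)
    hence "mdeg (dilate ?p m) = ?p * M" using x by (simp add: limit_grading_coef)
    thus ?thesis using mdeg_dilate[OF p0, of m] p0 by simp
  qed
  have coef_a: "coef (of_coef (a b)) = a b" for b
    by (rule coef_of_coef[of _ M]) (use a_deg in auto)
  have "x = (\<Sum>b\<in>B. limit_of_const b * of_coef (a b) ^ ?p)"
  proof (rule coef_eqI)
    fix m
    show "coef x m = coef (\<Sum>b\<in>B. limit_of_const b * of_coef (a b) ^ ?p) m"
    proof (cases "\<exists>m'. m = dilate ?p m'")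
      case True
      then obtain m' where m: "m = dilate ?p m'" by blast
      show ?thesis
        using \<delta>[of m] p0 unfolding m coef_frobenius_combination(1)[OF p]
        by (cases "coef x (dilate ?p m') = 0") (auto simp: coef_a a_def power_0_left)
    next
      case False
      have "coef x m = 0"
      proof (rule ccontr)
        assume "coef x m \<noteq> 0"
        hence "\<exists>m'. m = dilate ?p m'" by (intro dilate_exI dvd)
        with False show False by contradiction
      qed
      moreover have "coef (\<Sum>b\<in>B. limit_of_const b * of_coef (a b) ^ ?p) m = 0"
        by (rule coef_frobenius_combination(2)[OF p]) (use False in blast)
      ultimately show ?thesis by simp
    qed
  qed
  moreover have "of_coef (a b) \<in> limit_grading M" for b
    using a_deg by (auto simp: limit_grading_coef coef_a)
  ultimately show ?thesis by (intro exI[of _ "\<lambda>b. of_coef (a b)"]) blast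
qed

lemma hasse_algebra_limit:
  "hasse_algebra limit_of_const (limit_grading :: nat \<Rightarrow> 'k::field graded_limit set) taylor_expansion"
proof (intro hasse_algebra.intro connected_graded_algebra_limit hasse_algebra_axioms.intro)
  show "taylor_hom (taylor_expansion j :: 'k graded_limit \<Rightarrow> _)" for j
  proof
    fix x y :: "'k graded_limit"
    show "taylor_expansion j (x + y) = taylor_expansion j x + taylor_expansion j y"
      by (rule poly_eqI, rule coef_eqI)
         (simp add: coeff_taylor_expansion coef_hasse coef_add algebra_simps)
    show "taylor_expansion j (x * y) = taylor_expansion j x * taylor_expansion j y"
      by (rule poly_eqI) (simp add: coeff_taylor_expansion coeff_mult hasse_mult)
  qed
  show "taylor_expansion j (limit_of_const a) = [:limit_of_const a:]" for j and a :: 'k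
  proof (rule poly_eqI)
    fix r
    have "hasse j r (limit_of_const a) = 0" if "r > 0"
    proof (rule coef_eqI)
      fix m
      have "m + Poly_Mapping.single j r \<noteq> 0"
        using that by (metis add_is_0 lookup_add lookup_single_eq lookup_zero less_irrefl)
      thus "coef (hasse j r (limit_of_const a)) m = coef 0 m"
        by (simp add: coef_hasse coef_const coef_zero)
    qed
    thus "coeff (taylor_expansion j (limit_of_const a)) r = coeff [:limit_of_const a:] r"
      by (cases r) (auto simp: coeff_taylor_expansion)
  qed
  show "coeff (taylor_expansion j x) 0 = x" for j and x :: "'k graded_limit"
    by (simp add: coeff_taylor_expansion)
  fix x :: "'k graded_limit" and n
  assume x: "x \<in> limit_grading n"
  have deg: "mdeg m + r = n" if "coef (hasse j r x) m \<noteq> 0" for j r m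
    using that x by (auto simp: coef_hasse limit_grading_coef mdeg_add mdeg_single)
  show "coeff (taylor_expansion j x) r \<in> limit_grading (n - r)" for j r
    using deg[of j r] unfolding limit_grading_coef coeff_taylor_expansion by force
  show "coeff (taylor_expansion j x) r = 0" if "n < r" for j r
    unfolding coeff_taylor_expansion by (rule coef_eqI) (use deg[of j r] that in \<open>force simp: coef_zero\<close>)
  show "x = 0" if n: "n > 0" and z: "\<And>j r. r > 0 \<Longrightarrow> coeff (taylor_expansion j x) r = 0"
  proof (rule coef_eqI, rule ccontr)
    fix m assume "coef x m \<noteq> coef 0 m"
    hence nz: "coef x m \<noteq> 0" by (simp add: coef_zero)
    hence "mdeg m > 0" using x n by (simp add: limit_grading_coef)
    then obtain j where "Poly_Mapping.lookup m j > 0" by (rule mdeg_pos_obtain)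
    thus False using z[of "Poly_Mapping.lookup m j" j] coef_hasse_top[of j m x] nz
      by (simp add: coeff_taylor_expansion coef_zero)
  qed
qed (unfold coeff_taylor_expansion, rule frobenius_combination_from_hasse)


section \<open>The inverse limit is a polynomial ring\<close>

theorem theorem1p1:
  shows "is_polynomial_ring (limit_of_const :: 'k::field \<Rightarrow> 'k graded_limit) limit_grading"
  by (rule hasse_algebra.polynomial_ring[OF hasse_algebra_limit])

end
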